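(* Let $X$ be a set of cardinality $n$ with $1\leq n<\infty$. Then the free medial Latin quandle $\mathrm{FML}(X)$ and the free medial commutative quandle $\mathrm{FMC}(X)$ generated by $X$ are given by $$\mathrm{FML}(X)\cong \mathrm{Alex}(\mathbb{L}^{n-1},\varphi),\qquad \mathrm{FMC}(X)\cong(\mathbb{D}^{n-1})_{\mathrm{mid}},$$ where $\varphi$ denotes multiplication by $t$, $\mathbb{L}=\mathbb{Z}[t^{\pm1},(1-t)^{-1}]$, and $\mathbb{D}=\mathbb{Z}[1/2]$.
   Context: A magma $(X,\ast)$ is a set with a binary operation; homomorphisms are maps preserving the operation. For $x\in X$, let $R_x\colon y\mapsto y\ast x$ and $L_x\colon y\mapsto x\ast y$. A rack is a magma in which every $R_x$ is an automorphism of the magma. A quandle is a rack with $x\ast x=x$ for all $x$. A magma is medial if $(a\ast b)\ast(c\ast d)=(a\ast c)\ast(b\ast d)$ for all $a,b,c,d$; Latin if every $L_x$ is a permutation; commutative if $x\ast y=y\ast x$ for all $x,y$. $\mathbb{L}=\mathbb{Z}[t^{\pm1},(1-t)^{-1}]$ is the localization of $\mathbb{Z}[t]$ inverting $t$ and $1-t$. For an abelian group $A$ and an automorphism $\varphi$ of $A$, $\mathrm{Alex}(A,\varphi)$ is the quandle on $A$ with $x\ast y:=\varphi(x)+(\mathrm{id}-\varphi)(y)$. For a $\mathbb{D}$-module $M$, $M_{\mathrm{mid}}$ is the quandle on $M$ with $x\ast y:=\frac12(x+y)$. The free medial Latin (resp. medial commutative) quandle generated by a set $X$ is a medial Latin (resp.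 medial commutative) quandle $F$ with an injective map $\iota\colon X\to F$ such that for every medial Latin (resp. medial commutative) quandle $Q$ and every function $f\colon X\to Q$ there is a unique quandle homomorphism $\tilde f\colon F\to Q$ with $\tilde f\circ\iota=f$. *)

theory Defs
  imports
    "HOL-Algebra.Module"
    "HOL-Library.FuncSet"
    "HOL-Computational_Algebra.Polynomial"
    "HOL-Computational_Algebra.Fraction_Field"
begin

record 'a magma = "'a partial_object" +
  mop :: "'a \<Rightarrow> 'a \<Rightarrow> 'a"  (infixl \<open>\<star>\<index>\<close> 70)

locale magma =
  fixes Q (structure)
  assumes closed: "x \<in> carrier Q \<Longrightarrow> y \<in> carrier Q \<Longrightarrow> x \<star> y \<in> carrier Q"

definition magma_hom :: "'a magma \<Rightarrow> 'b magma \<Rightarrow> ('a \<Rightarrow> 'b) set" where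
  "magma_hom P Q = {h \<in> carrier P \<rightarrow> carrier Q.
     \<forall>x\<in>carrier P. \<forall>y\<in>carrier P. h (x \<star>\<^bsub>P\<^esub> y) = h x \<star>\<^bsub>Q\<^esub> h y}"

definition magma_iso :: "'a magma \<Rightarrow> 'b magma \<Rightarrow> ('a \<Rightarrow> 'b) set" where
  "magma_iso P Q = {h \<in> magma_hom P Q. bij_betw h (carrier P) (carrier Q)}"

definition magma_isomorphic :: "'a magma \<Rightarrow> 'b magma \<Rightarrow> bool"  (infix \<open>\<cong>\<^sub>m\<close> 60) where
  "P \<cong>\<^sub>m Q \<longleftrightarrow> magma_iso P Q \<noteq> {}"

locale rack = magma Q for Q :: "'a magma" (structure) +
  assumes right_translation_auto: "x \<in> carrier Q \<Longrightarrow> (\<lambda>y. y \<star> x) \<in> magma_iso Q Q"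

locale quandle = rack +
  assumes idem: "x \<in> carrier Q \<Longrightarrow> x \<star> x = x"

locale medial_quandle = quandle +
  assumes medial: "\<lbrakk>a \<in> carrier Q; b \<in> carrier Q; c \<in> carrier Q; d \<in> carrier Q\<rbrakk>
    \<Longrightarrow> (a \<star> b) \<star> (c \<star> d) = (a \<star> c) \<star> (b \<star> d)"

locale medial_latin_quandle = medial_quandle +
  assumes latin: "x \<in> carrier Q \<Longrightarrow> bij_betw (\<lambda>y. x \<star> y) (carrier Q) (carrier Q)"

locale medial_commutative_quandle = medial_quandle +
  assumes commutative: "x \<in> carrier Q \<Longrightarrow> y \<in> carrier Q \<Longrightarrow> x \<star> y = y \<star> x"

text \<open>
  Universal property of \<open>\<iota> : X \<rightarrow> F\<close> with respect to the magmas satisfying \<open>P\<close>. HOL cannot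
  quantify over types inside a formula, so the test objects \<open>Q\<close> have carriers contained in the
  one type \<open>'q\<close>. Asserted with \<open>'q\<close> a free type variable, the property covers all of them; assumed
  of \<open>F\<close>, it is needed only for the types of \<open>F\<close> and of the explicit model \<open>F\<close> is compared with,
  which is a weaker hypothesis than freeness with respect to every type. Uniqueness of the
  extension is uniqueness on the carrier of \<open>F\<close>, whence the restriction to extensional maps.
\<close>

definition universal_for ::
    "('q magma \<Rightarrow> bool) \<Rightarrow> 'x set \<Rightarrow> 'f magma \<Rightarrow> ('x \<Rightarrow> 'f) \<Rightarrow> bool" where
  "universal_for P X F \<iota> \<longleftrightarrow> (\<forall>Q. P Q \<longrightarrow> (\<forall>f \<in> X \<rightarrow> carrier Q.
     \<exists>!h. h \<in> magma_hom F Q \<and> h \<in> extensional (carrier F) \<and> (\<forall>x\<in>X. h (\<iota> x) = f x)))"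

definition free_medial_latin ::
    "'q itself \<Rightarrow> 'x set \<Rightarrow> 'f magma \<Rightarrow> ('x \<Rightarrow> 'f) \<Rightarrow> bool" where
  "free_medial_latin (_ :: 'q itself) X F \<iota> \<longleftrightarrow>
     medial_latin_quandle F \<and> \<iota> \<in> X \<rightarrow> carrier F \<and> inj_on \<iota> X \<and>
     universal_for (medial_latin_quandle :: 'q magma \<Rightarrow> bool) X F \<iota>"

definition free_medial_commutative ::
    "'q itself \<Rightarrow> 'x set \<Rightarrow> 'f magma \<Rightarrow> ('x \<Rightarrow> 'f) \<Rightarrow> bool" where
  "free_medial_commutative (_ :: 'q itself) X F \<iota> \<longleftrightarrow>
     medial_commutative_quandle F \<and> \<iota> \<in> X \<rightarrow> carrier F \<and> inj_on \<iota> X \<and>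
     universal_for (medial_commutative_quandle :: 'q magma \<Rightarrow> bool) X F \<iota>"

text \<open>
  \<open>\<int>[t]\<close> is a domain, so its localization is the subring of the fraction field consisting of the
  fractions whose denominator is a product of powers of \<open>t = [:0, 1:]\<close> and \<open>1 - t = [:1, -1:]\<close>.
\<close>

definition ring_on :: "'a::comm_ring_1 set \<Rightarrow> 'a ring" where
  "ring_on S = \<lparr>carrier = S, monoid.mult = (*), one = 1, zero = 0, add = (+)\<rparr>"

definition LL :: "int poly fract ring" where
  "LL = ring_on {Fract p ([:0, 1:] ^ i * [:1, -1:] ^ j) | p i j. True}"

definition LL_t :: "int poly fract" where
  "LL_t = Fract [:0, 1:] 1"

definition DD :: "rat ring" where
  "DD = ring_on {of_int a / 2 ^ k | a k. True}"

text \<open>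
  \<open>R\<^sup>k\<close> as a module over \<open>R\<close>. The record type of modules extends that of rings; the
  multiplicative part is irrelevant for a module and is taken to be the componentwise one.
\<close>

definition free_module :: "('a, 'm) ring_scheme \<Rightarrow> nat \<Rightarrow> ('a, nat \<Rightarrow> 'a) module" where
  "free_module R k =
    \<lparr>carrier = {..<k} \<rightarrow>\<^sub>E carrier R,
     monoid.mult = (\<lambda>v w. \<lambda>i\<in>{..<k}. v i \<otimes>\<^bsub>R\<^esub> w i),
     one = (\<lambda>i\<in>{..<k}. \<one>\<^bsub>R\<^esub>),
     zero = (\<lambda>i\<in>{..<k}. \<zero>\<^bsub>R\<^esub>),
     add = (\<lambda>v w. \<lambda>i\<in>{..<k}. v i \<oplus>\<^bsub>R\<^esub> w i),
     module.smult = (\<lambda>a v. \<lambda>i\<in>{..<k}. a \<otimes>\<^bsub>R\<^esub> v i)\<rparr>"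

definition Alex :: "('a, 'm) ring_scheme \<Rightarrow> ('a \<Rightarrow> 'a) \<Rightarrow> 'a magma" where
  "Alex A \<phi> = \<lparr>carrier = carrier A, mop = (\<lambda>x y. \<phi> x \<oplus>\<^bsub>A\<^esub> (y \<ominus>\<^bsub>A\<^esub> \<phi> y))\<rparr>"

definition mid :: "(rat, 'a, 'm) module_scheme \<Rightarrow> 'a magma" where
  "mid M = \<lparr>carrier = carrier M, mop = (\<lambda>x y. (1 / 2) \<odot>\<^bsub>M\<^esub> (x \<oplus>\<^bsub>M\<^esub> y))\<rparr>"

lemma cring_ring_on:
  assumes "0 \<in> S" "1 \<in> S"
    and "\<And>x y. x \<in> S \<Longrightarrow> y \<in> S \<Longrightarrow> x + y \<in> S"
    and "\<And>x y. x \<in> S \<Longrightarrow> y \<in> S \<Longrightarrow> x * y \<in> S"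
    and neg: "\<And>x. x \<in> S \<Longrightarrow> - x \<in> S"
  shows "cring (ring_on S)"
proof (intro cringI abelian_groupI comm_monoidI)
  fix x assume "x \<in> carrier (ring_on S)"
  then show "\<exists>y\<in>carrier (ring_on S). y \<oplus>\<^bsub>ring_on S\<^esub> x = \<zero>\<^bsub>ring_on S\<^esub>"
    using neg[of x] by (intro bexI[of _ "- x"]) (auto simp: ring_on_def)
qed (use assms in \<open>auto simp: ring_on_def algebra_simps\<close>)

lemma cring_LL: "cring LL"
  unfolding LL_def
proof (rule cring_ring_on)
  let ?d = "\<lambda>i j. [:0, 1:] ^ i * [:1, -1:] ^ j :: int poly"
  let ?S = "{Fract p (?d i j) | p i j. True}"
  have nz: "?d i j \<noteq> 0" for i j by simp
  have mult: "?d i j * ?d k l = ?d (i + k) (j + l)" for i j k l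
    by (simp add: power_add ac_simps)
  show "0 \<in> ?S"
    by (auto simp: Zero_fract_def intro!: exI[of _ 0])
  show "1 \<in> ?S"
    by (intro CollectI exI[of _ 1] exI[of _ 0]) (simp add: One_fract_def)
  fix x assume "x \<in> ?S"
  then obtain p i j where x: "x = Fract p (?d i j)" by blast
  show "- x \<in> ?S" unfolding x minus_fract by blast
  fix y assume "y \<in> ?S"
  then obtain q k l where y: "y = Fract q (?d k l)" by blast
  show "x + y \<in> ?S" unfolding x y add_fract[OF nz nz] mult by blast
  show "x * y \<in> ?S" unfolding x y mult_fract mult by blast
qed

lemma cring_DD: "cring DD"
  unfolding DD_def
proof (rule cring_ring_on)
  let ?S = "{of_int a / 2 ^ k :: rat | a k. True}"
  show "0 \<in> ?S" "1 \<in> ?S"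
    by (force intro: exI[of _ 0] exI[of _ 1] exI[of _ "0::nat"])+
  fix x :: rat assume "x \<in> ?S"
  then obtain a k where x: "x = of_int a / 2 ^ k" by blast
  have "- x = of_int (- a) / 2 ^ k" by (simp add: x)
  then show "- x \<in> ?S" by blast
  fix y :: rat assume "y \<in> ?S"
  then obtain b l where y: "y = of_int b / 2 ^ l" by blast
  have "x + y = of_int (a * 2 ^ l + b * 2 ^ k) / 2 ^ (k + l)"
    by (simp add: x y field_simps power_add)
  then show "x + y \<in> ?S" by blast
  have "x * y = of_int (a * b) / 2 ^ (k + l)"
    by (simp add: x y power_add)
  then show "x * y \<in> ?S" by blast
qed

lemma Units_ring_on:
  assumes "x \<in> carrier (ring_on S)" "y \<in> carrier (ring_on S)" "x * y = 1"
  shows "x \<in> Units (ring_on S)"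
  using assms by (auto simp: Units_def ring_on_def mult.commute intro!: bexI[of _ y])

lemma LL_units:
  shows "LL_t \<in> Units LL" and "1 - LL_t \<in> Units LL"
proof -
  have mem: "Fract p ([:0, 1:] ^ i * [:1, -1:] ^ j) \<in> carrier LL" for p i j
    by (auto simp: LL_def ring_on_def)
  have t: "LL_t \<in> carrier LL" "1 - LL_t \<in> carrier LL"
    using mem[of "[:0, 1:]" 0 0] mem[of "[:1, -1:]" 0 0]
    by (simp_all add: LL_t_def One_fract_def one_pCons)
  have u: "Fract 1 [:0, 1:] \<in> carrier LL" and v: "Fract 1 [:1, -1:] \<in> carrier LL"
    using mem[of 1 1 0] mem[of 1 0 1] by simp_all
  have "LL_t * Fract 1 [:0, 1:] = 1" "(1 - LL_t) * Fract 1 [:1, -1:] = 1"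
    by (simp_all add: LL_t_def One_fract_def eq_fract one_pCons)
  then show "LL_t \<in> Units LL" "1 - LL_t \<in> Units LL"
    using t u v by (auto simp: LL_def intro: Units_ring_on)
qed

lemma free_module_simps:
  "v \<in> carrier (free_module R k) \<longleftrightarrow> (\<forall>i<k. v i \<in> carrier R) \<and> v \<in> extensional {..<k}"
  "v \<oplus>\<^bsub>free_module R k\<^esub> w = (\<lambda>i\<in>{..<k}. v i \<oplus>\<^bsub>R\<^esub> w i)"
  "\<zero>\<^bsub>free_module R k\<^esub> = (\<lambda>i\<in>{..<k}. \<zero>\<^bsub>R\<^esub>)"
  "a \<odot>\<^bsub>free_module R k\<^esub> v = (\<lambda>i\<in>{..<k}. a \<otimes>\<^bsub>R\<^esub> v i)"
  by (auto simp: free_module_def PiE_iff)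

lemma module_free_module:
  assumes "cring R"
  shows "Module.module R (free_module R k)"
proof -
  interpret cring R by fact
  note simps = free_module_simps fun_eq_iff restrict_def extensional_def
  show ?thesis
  proof (intro Module.moduleI abelian_groupI)
    fix v assume "v \<in> carrier (free_module R k)"
    then show "\<exists>w\<in>carrier (free_module R k).
        w \<oplus>\<^bsub>free_module R k\<^esub> v = \<zero>\<^bsub>free_module R k\<^esub>"
      by (intro bexI[of _ "\<lambda>i\<in>{..<k}. \<ominus>\<^bsub>R\<^esub> v i"]) (simp_all add: simps l_neg)
  next
    fix v w assume "v \<in> carrier (free_module R k)" "w \<in> carrier (free_module R k)"
    then show "v \<oplus>\<^bsub>free_module R k\<^esub> w = w \<oplus>\<^bsub>free_module R k\<^esub> v"
      by (simp add: simps a_comm)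
  qed (simp_all add: simps is_cring a_assoc m_assoc l_distr r_distr)
qed

end

theory Submission
  imports Defs
begin

text \<open>
  Both halves are the same statement about two rings. Let \<open>R\<close> be \<open>\<int>[t\<^sup>\<plusminus>\<^sup>1, (1 - t)\<^sup>-\<^sup>1]\<close> with \<open>s = t\<close>,
  or \<open>\<int>[1/2]\<close> with \<open>s = 1/2\<close>; then \<open>s\<close> and \<open>1 - s\<close> are units of \<open>R\<close>, and the quandle in question is
  \<open>R\<^sup>k\<close> with \<open>v \<star> w = s v + (1 - s) w\<close>, where \<open>k = n - 1\<close>. It is freely generated by the affine frame
  consisting of the unit vectors \<open>e\<^sub>0, \<dots>, e\<^sub>k\<^sub>-\<^sub>1\<close> and the origin: one generator is spent on
  choosing an origin, which is why the rank is \<open>n - 1\<close>.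

  Uniqueness of extensions. A homomorphism between Latin quandles preserves both divisions, so the
  set where two homomorphisms agree is closed under \<open>\<star>\<close> and under both divisions. Such a set containing
  the origin is closed under multiplication by \<open>s\<close>, \<open>1 - s\<close> and their inverses, since these are the
  left and right translations by the origin and their inverses; hence it is closed under addition and
  negation as well. As \<open>R\<close> is generated as a ring by \<open>s\<close>, \<open>1/s\<close> and \<open>1/(1 - s)\<close>, the set
  is everything once it contains the unit vectors (\<open>frame_generates\<close>, \<open>hom_unique\<close>).

  Existence of extensions. Let \<open>Q\<close> be medial and Latin, and fix \<open>e\<close> in \<open>Q\<close>. Following Bruck and
  Toyoda, \<open>x \<oplus> y = (x / e) \<star> (e \ y)\<close> is an abelian group with zero \<open>e\<close>, the two translations by \<open>e\<close>
  are automorphisms of it, and \<open>x \<star> y = (x \<star> e) \<oplus> (e \<star> y)\<close> (\<open>abelian_group_at\<close>,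
  \<open>translation_additive\<close>, \<open>op_eq_group_at\<close>). Taking \<open>x = y\<close> shows that \<open>x \<mapsto> e \<star> x\<close> is the
  identity minus \<open>x \<mapsto> x \<star> e\<close>, so \<open>Q\<close> is an Alexander quandle and its group is an \<open>R\<close>-module on
  which \<open>s\<close> acts as the right translation by \<open>e\<close>. Over \<open>\<int>[t]\<close> this action is evaluation of
  polynomials, and it extends to the localization because both translations are invertible. When \<open>Q\<close> is
  commutative, the two translations coincide and sum to the identity, so each is a halving map and
  \<open>\<int>[1/2]\<close> acts. If \<open>e\<close> is the prescribed value at the origin and \<open>q\<^sub>i\<close> the one at \<open>e\<^sub>i\<close>, the
  required homomorphism is \<open>v \<mapsto> \<Sum>\<^sub>i v\<^sub>i q\<^sub>i\<close> (\<open>hom_exists\<close>).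

  The remaining claim is the uniqueness of free objects up to isomorphism (\<open>universal_unique\<close>).
\<close>

section \<open>The abelian group of a medial Latin quandle\<close>

context medial_latin_quandle
begin

definition rdiv :: "'a \<Rightarrow> 'a \<Rightarrow> 'a" where
  "rdiv x e = inv_into (carrier Q) (\<lambda>y. y \<star> e) x"

definition ldiv :: "'a \<Rightarrow> 'a \<Rightarrow> 'a" where
  "ldiv e x = inv_into (carrier Q) (\<lambda>y. e \<star> y) x"

lemma right_translation_bij:
  assumes "e \<in> carrier Q"
  shows "bij_betw (\<lambda>y. y \<star> e) (carrier Q) (carrier Q)"
  using right_translation_auto[OF assms] by (simp add: magma_iso_def)

lemma rdiv_closed [simp]: "e \<in> carrier Q \<Longrightarrow> x \<in> carrier Q \<Longrightarrow> rdiv x e \<in> carrier Q"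
  unfolding rdiv_def using right_translation_bij by (metis bij_betw_def inv_into_into)

lemma ldiv_closed [simp]: "e \<in> carrier Q \<Longrightarrow> x \<in> carrier Q \<Longrightarrow> ldiv e x \<in> carrier Q"
  unfolding ldiv_def using latin by (metis bij_betw_def inv_into_into)

lemma rdiv_cancel [simp]:
  assumes "e \<in> carrier Q" "x \<in> carrier Q"
  shows "rdiv x e \<star> e = x" "rdiv (x \<star> e) e = x"
  using bij_betw_inv_into_right[OF right_translation_bij, of e x]
    bij_betw_inv_into_left[OF right_translation_bij, of e x] assms
  by (simp_all add: rdiv_def)

lemma ldiv_cancel [simp]:
  assumes "e \<in> carrier Q" "x \<in> carrier Q"
  shows "e \<star> ldiv e x = x" "ldiv e (e \<star> x) = x"
  using bij_betw_inv_into_right[OF latin, of e x] bij_betw_inv_into_left[OF latin, of e x] assms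
  by (simp_all add: ldiv_def)

lemma right_cancel:
  assumes "e \<in> carrier Q" "x \<in> carrier Q" "y \<in> carrier Q" "x \<star> e = y \<star> e"
  shows "x = y"
  using rdiv_cancel(2)[of e] assms by metis

lemma left_cancel:
  assumes "e \<in> carrier Q" "x \<in> carrier Q" "y \<in> carrier Q" "e \<star> x = e \<star> y"
  shows "x = y"
  using ldiv_cancel(2)[of e] assms by metis

text \<open>
  Mediality with a repeated \<open>e\<close>, since \<open>e = e \<star> e\<close> by idempotence.
\<close>
lemma translation_distrib:
  assumes "e \<in> carrier Q" "x \<in> carrier Q" "y \<in> carrier Q"
  shows "(x \<star> y) \<star> e = (x \<star> e) \<star> (y \<star> e)" "e \<star> (x \<star> y) = (e \<star> x) \<star> (e \<star> y)"
    "(e \<star> x) \<star> e = e \<star> (x \<star> e)"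
  using medial[of x y e e] medial[of e e x y] medial[of e x e e] assms by (simp_all add: idem)

lemma division_distrib:
  assumes e: "e \<in> carrier Q" and "x \<in> carrier Q" "y \<in> carrier Q"
  shows "rdiv (x \<star> y) e = rdiv x e \<star> rdiv y e" "ldiv e (x \<star> y) = ldiv e x \<star> ldiv e y"
    "rdiv (ldiv e x) e = ldiv e (rdiv x e)"
    "rdiv (e \<star> x) e = e \<star> rdiv x e" "ldiv e (x \<star> e) = ldiv e x \<star> e"
proof -
  show "rdiv (e \<star> x) e = e \<star> rdiv x e"
    by (rule right_cancel[OF e]) (use assms in \<open>simp_all add: closed translation_distrib(3)\<close>)
  show "ldiv e (x \<star> e) = ldiv e x \<star> e"
    by (rule left_cancel[OF e]) (use assms in \<open>simp_all add: closed translation_distrib(3)[symmetric]\<close>)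
  show "rdiv (x \<star> y) e = rdiv x e \<star> rdiv y e"
    by (rule right_cancel[OF e]) (use assms in \<open>simp_all add: closed translation_distrib(1)\<close>)
  show "ldiv e (x \<star> y) = ldiv e x \<star> ldiv e y"
    by (rule left_cancel[OF e]) (use assms in \<open>simp_all add: closed translation_distrib(2)\<close>)
  show "rdiv (ldiv e x) e = ldiv e (rdiv x e)"
  proof (rule left_cancel[OF e])
    have "e \<star> rdiv (ldiv e x) e = rdiv (e \<star> ldiv e x) e"
      by (rule right_cancel[OF e]) (use assms in \<open>simp_all add: closed translation_distrib(3)\<close>)
    then show "e \<star> rdiv (ldiv e x) e = e \<star> ldiv e (rdiv x e)"
      using assms by simp
  qed (use assms in simp_all)
qed

text \<open>
  The only structure of interest is the additive group; the record for rings also asks for a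
  multiplication and a unit, and these fields are filled by the addition and its zero.
\<close>
definition group_at :: "'a \<Rightarrow> 'a ring" where
  "group_at e = \<lparr>carrier = carrier Q, monoid.mult = (\<lambda>x y. rdiv x e \<star> ldiv e y), one = e,
     zero = e, add = (\<lambda>x y. rdiv x e \<star> ldiv e y)\<rparr>"

lemma group_at_simps [simp]:
  "carrier (group_at e) = carrier Q" "\<zero>\<^bsub>group_at e\<^esub> = e"
  by (simp_all add: group_at_def)

lemma group_at_add: "x \<oplus>\<^bsub>group_at e\<^esub> y = rdiv x e \<star> ldiv e y"
  by (simp add: group_at_def)

lemma base_div [simp]: "e \<in> carrier Q \<Longrightarrow> rdiv e e = e" "e \<in> carrier Q \<Longrightarrow> ldiv e e = e"
  using rdiv_cancel(2)[of e e] ldiv_cancel(2)[of e e] by (simp_all add: idem)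

text \<open>
  The divisions by \<open>e\<close> are commuting automorphisms of \<open>\<star>\<close>, so mediality passes to the
  addition. Together with the neutral element \<open>e\<close> this gives associativity and commutativity, by the
  Eckmann-Hilton argument.
\<close>
lemma group_at_interchange:
  assumes e: "e \<in> carrier Q"
    and xy: "x \<in> carrier Q" "y \<in> carrier Q" "z \<in> carrier Q" "w \<in> carrier Q"
  shows "(x \<oplus>\<^bsub>group_at e\<^esub> y) \<oplus>\<^bsub>group_at e\<^esub> (z \<oplus>\<^bsub>group_at e\<^esub> w)
       = (x \<oplus>\<^bsub>group_at e\<^esub> z) \<oplus>\<^bsub>group_at e\<^esub> (y \<oplus>\<^bsub>group_at e\<^esub> w)"
  using assms by (simp add: group_at_add division_distrib medial closed)

lemma abelian_group_at:
  assumes e: "e \<in> carrier Q"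
  shows "abelian_group (group_at e)"
proof -
  let ?G = "group_at e"
  have cl: "x \<oplus>\<^bsub>?G\<^esub> y \<in> carrier Q" if "x \<in> carrier Q" "y \<in> carrier Q" for x y
    using that e by (simp add: group_at_add closed)
  have unit: "e \<oplus>\<^bsub>?G\<^esub> x = x" "x \<oplus>\<^bsub>?G\<^esub> e = x" if "x \<in> carrier Q" for x
    using that e by (simp_all add: group_at_add)
  show ?thesis
  proof (rule abelian_groupI; unfold group_at_simps)
    fix x y z assume "x \<in> carrier Q" "y \<in> carrier Q" "z \<in> carrier Q"
    then show "x \<oplus>\<^bsub>?G\<^esub> y \<oplus>\<^bsub>?G\<^esub> z = x \<oplus>\<^bsub>?G\<^esub> (y \<oplus>\<^bsub>?G\<^esub> z)"
      using group_at_interchange[OF e, of x y e z] e by (simp add: unit)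
  next
    fix x y assume "x \<in> carrier Q" "y \<in> carrier Q"
    then show "x \<oplus>\<^bsub>?G\<^esub> y = y \<oplus>\<^bsub>?G\<^esub> x"
      using group_at_interchange[OF e, of e x y e] e by (simp add: unit)
  next
    fix x assume x: "x \<in> carrier Q"
    let ?y = "rdiv e (ldiv e x) \<star> e"
    have "?y \<oplus>\<^bsub>?G\<^esub> x = e"
      using x e by (simp add: group_at_add)
    then show "\<exists>y\<in>carrier Q. y \<oplus>\<^bsub>?G\<^esub> x = e"
      using x e by (intro bexI[of _ ?y]) (simp_all add: closed)
  qed (use e cl unit in auto)
qed

lemma group_at_cancel:
  assumes e: "e \<in> carrier Q" and xyz: "x \<in> carrier Q" "y \<in> carrier Q" "z \<in> carrier Q"
    and eq: "x \<oplus>\<^bsub>group_at e\<^esub> y = x \<oplus>\<^bsub>group_at e\<^esub> z"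
  shows "y = z"
proof -
  have "ldiv e y = ldiv e z"
    by (rule left_cancel[of "rdiv x e"]) (use e xyz eq in \<open>simp_all add: group_at_add\<close>)
  then show ?thesis
    using ldiv_cancel(1)[OF e] xyz(2,3) by metis
qed

lemma op_eq_group_at:
  assumes "e \<in> carrier Q" "x \<in> carrier Q" "y \<in> carrier Q"
  shows "x \<star> y = (x \<star> e) \<oplus>\<^bsub>group_at e\<^esub> (e \<star> y)"
  using assms by (simp add: group_at_add)

lemma translation_additive:
  assumes "e \<in> carrier Q" "x \<in> carrier Q" "y \<in> carrier Q"
  shows "(x \<oplus>\<^bsub>group_at e\<^esub> y) \<star> e = (x \<star> e) \<oplus>\<^bsub>group_at e\<^esub> (y \<star> e)"
    "e \<star> (x \<oplus>\<^bsub>group_at e\<^esub> y) = (e \<star> x) \<oplus>\<^bsub>group_at e\<^esub> (e \<star> y)"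
  using assms translation_distrib(1,2)[of e "rdiv x e" "ldiv e y"]
  by (simp_all add: group_at_add division_distrib(4,5))

end

text \<open>
  The left translations are the right translations, and these are bijective in every rack.
\<close>
lemma (in medial_commutative_quandle) medial_latin: "medial_latin_quandle Q"
proof
  fix x assume x: "x \<in> carrier Q"
  have "bij_betw (\<lambda>y. y \<star> x) (carrier Q) (carrier Q)"
    using right_translation_auto[OF x] by (simp add: magma_iso_def)
  then show "bij_betw (\<lambda>y. x \<star> y) (carrier Q) (carrier Q)"
    by (rule bij_betw_cong[THEN iffD1, rotated]) (simp add: commutative x)
qed

section \<open>Orbits of one element under the scalars\<close>

text \<open>
  Inverting \<open>d\<close>. An additive map \<open>g\<close> on which multiplication by \<open>d\<close> corresponds to an automorphism
  \<open>\<delta>\<close> extends to the fractions \<open>p / d\<^sup>k\<close> by \<open>p / d\<^sup>k \<mapsto> \<delta>\<^sup>-\<^sup>k (g p)\<close>. The last conclusion is that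
  every operator commuting with \<open>\<delta>\<close> that corresponds to a scalar before the extension still does so
  after it; this carries over the action of \<open>t\<close> when \<open>d = t (1 - t)\<close>, and that of \<open>2\<close> when \<open>d = 2\<close>.
\<close>
lemma extend_to_localization:
  fixes j :: "'r::comm_ring_1 \<Rightarrow> 'k::field" and d :: 'r and G :: "('g, 'm) ring_scheme"
  defines "S \<equiv> {j p / j d ^ k | p k. True}"
  assumes j: "\<And>p q. j (p + q) = j p + j q" "\<And>p q. j (p * q) = j p * j q" "j 1 = 1" "inj j"
    and d: "j d \<noteq> 0"
    and g: "\<And>p. g p \<in> carrier G" "\<And>p q. g (p + q) = g p \<oplus>\<^bsub>G\<^esub> g q"
    and G: "abelian_group G"
    and \<delta>: "bij_betw \<delta> (carrier G) (carrier G)"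
      "\<And>x y. x \<in> carrier G \<Longrightarrow> y \<in> carrier G \<Longrightarrow> \<delta> (x \<oplus>\<^bsub>G\<^esub> y) = \<delta> x \<oplus>\<^bsub>G\<^esub> \<delta> y"
      "\<And>p. g (d * p) = \<delta> (g p)"
  obtains h where "h \<in> S \<rightarrow> carrier G" "\<And>p. h (j p) = g p"
    "\<And>x y. x \<in> S \<Longrightarrow> y \<in> S \<Longrightarrow> h (x + y) = h x \<oplus>\<^bsub>G\<^esub> h y"
    "\<And>c \<alpha> x. \<alpha> \<in> carrier G \<rightarrow> carrier G \<Longrightarrow> (\<And>z. z \<in> carrier G \<Longrightarrow> \<alpha> (\<delta> z) = \<delta> (\<alpha> z)) \<Longrightarrow>
       (\<And>p. g (c * p) = \<alpha> (g p)) \<Longrightarrow> x \<in> S \<Longrightarrow> h (j c * x) = \<alpha> (h x)"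
proof -
  interpret abelian_group G by (rule G)
  have bij: "bij_betw (\<delta> ^^ k) (carrier G) (carrier G)" for k
    using bij_betw_funpow[OF \<delta>(1)] .
  have \<delta>k_closed: "(\<delta> ^^ k) z \<in> carrier G" if "z \<in> carrier G" for k z
    using bij that by (rule bij_betwE[rule_format])
  have \<delta>k_inj: "z = z'" if "(\<delta> ^^ k) z = (\<delta> ^^ k) z'" "z \<in> carrier G" "z' \<in> carrier G" for k z z'
    using bij[of k] that by (auto simp: bij_betw_def inj_on_def)
  have \<delta>k_add: "(\<delta> ^^ k) (x \<oplus>\<^bsub>G\<^esub> y) = (\<delta> ^^ k) x \<oplus>\<^bsub>G\<^esub> (\<delta> ^^ k) y"
    if "x \<in> carrier G" "y \<in> carrier G" for k x y
    using that by (induction k) (simp_all add: \<delta>(2) \<delta>k_closed)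
  have g_pow: "g (d ^ k * p) = (\<delta> ^^ k) (g p)" for k p
    by (induction k) (simp_all add: \<delta>(3) mult.assoc)
  have j_pow: "j (d ^ k) = j d ^ k" for k
    by (induction k) (simp_all add: j)
  have uniq: "z = z'" if eq: "j p / j d ^ k = j q / j d ^ l" and z: "z \<in> carrier G" "(\<delta> ^^ k) z = g p"
    and z': "z' \<in> carrier G" "(\<delta> ^^ l) z' = g q" for p q k l z z'
  proof -
    have "j (d ^ l * p) = j (d ^ k * q)"
      using eq d by (simp add: j j_pow field_simps)
    then have *: "d ^ l * p = d ^ k * q"
      using \<open>inj j\<close> by (simp add: inj_def)
    have "(\<delta> ^^ (l + k)) z = g (d ^ l * p)"
      by (simp add: funpow_add z g_pow)
    moreover have "(\<delta> ^^ (l + k)) z' = g (d ^ k * q)"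
      by (simp add: funpow_add z' g_pow add.commute[of l])
    ultimately show ?thesis
      using \<delta>k_inj z(1) z'(1) * by metis
  qed
  \<comment> \<open>Avoids inverting \<open>\<delta>\<close>: the value at \<open>p / d\<^sup>k\<close> is the solution \<open>z\<close> of \<open>\<delta>\<^sup>k z = g p\<close>, and
      \<open>uniq\<close> says that it does not depend on how the fraction is written.\<close>
  define h where "h x = (THE z. z \<in> carrier G \<and> (\<exists>p k. x = j p / j d ^ k \<and> (\<delta> ^^ k) z = g p))" for x
  have h: "h (j p / j d ^ k) \<in> carrier G \<and> (\<delta> ^^ k) (h (j p / j d ^ k)) = g p" for p k
  proof -
    from bij[of k] g(1)[of p] obtain z where z: "z \<in> carrier G" "(\<delta> ^^ k) z = g p"
      by (metis bij_betw_imp_surj_on image_iff)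
    then have "h (j p / j d ^ k) = z"
      unfolding h_def by (intro the_equality conjI exI[of _ p] exI[of _ k] refl) (auto intro: uniq[symmetric])
    then show ?thesis using z by simp
  qed
  show ?thesis
  proof (rule that[of h])
    show "h \<in> S \<rightarrow> carrier G"
      using h by (auto simp: S_def)
    show "h (j p) = g p" for p
      using h[of p 0] by simp
    show "h (x + y) = h x \<oplus>\<^bsub>G\<^esub> h y" if "x \<in> S" "y \<in> S" for x y
    proof -
      from that obtain p k q l where x: "x = j p / j d ^ k" and y: "y = j q / j d ^ l"
        unfolding S_def by blast
      \<comment> \<open>Over the common denominator \<open>d\<^sup>N\<close>, additivity is that of \<open>g\<close> on the numerators.\<close>
      let ?N = "k + l" and ?p = "d ^ l * p" and ?q = "d ^ k * q"
      have x': "x = j ?p / j d ^ ?N" and y': "y = j ?q / j d ^ ?N"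
        using d by (simp_all add: x y j j_pow power_add)
      have xy: "x + y = j (?p + ?q) / j d ^ ?N"
        by (simp add: x' y' j add_divide_distrib)
      show ?thesis
      proof (rule \<delta>k_inj[of ?N])
        show "(\<delta> ^^ ?N) (h (x + y)) = (\<delta> ^^ ?N) (h x \<oplus>\<^bsub>G\<^esub> h y)"
          using h[of "?p + ?q" ?N] h[of ?p ?N] h[of ?q ?N] unfolding xy
          unfolding x' y' by (simp add: \<delta>k_add g)
      qed (use h[of "?p + ?q" ?N, folded xy] h[of ?p ?N, folded x'] h[of ?q ?N, folded y'] in auto)
    qed
    show "h (j c * x) = \<alpha> (h x)" if \<alpha>: "\<alpha> \<in> carrier G \<rightarrow> carrier G"
      "\<And>z. z \<in> carrier G \<Longrightarrow> \<alpha> (\<delta> z) = \<delta> (\<alpha> z)" "\<And>p. g (c * p) = \<alpha> (g p)" "x \<in> S" for c \<alpha> x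
    proof -
      from that obtain p k where x: "x = j p / j d ^ k"
        unfolding S_def by blast
      have cx: "j c * x = j (c * p) / j d ^ k"
        by (simp add: x j)
      have comm: "\<alpha> ((\<delta> ^^ k) z) = (\<delta> ^^ k) (\<alpha> z)" if "z \<in> carrier G" for z
        using that by (induction k) (simp_all add: \<alpha> \<delta>k_closed)
      show ?thesis
      proof (rule \<delta>k_inj[of k])
        show "(\<delta> ^^ k) (h (j c * x)) = (\<delta> ^^ k) (\<alpha> (h x))"
          using h[of "c * p" k] h[of p k] unfolding cx unfolding x by (simp add: comm[symmetric] \<alpha>)
      qed (use h[of "c * p" k, folded cx] h[of p k, folded x] \<alpha>(1) in auto)
    qed
  qed
qed

text \<open>
  The action \<open>p \<mapsto> p(\<alpha>) q\<close> of \<open>\<int>[t]\<close> on an abelian group with an endomorphism \<open>\<alpha>\<close>, evaluated at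
  one element by the Horner scheme.
\<close>
lemma polynomial_orbit:
  assumes G: "abelian_group G" and \<alpha>: "\<alpha> \<in> carrier G \<rightarrow> carrier G"
    "\<And>x y. x \<in> carrier G \<Longrightarrow> y \<in> carrier G \<Longrightarrow> \<alpha> (x \<oplus>\<^bsub>G\<^esub> y) = \<alpha> x \<oplus>\<^bsub>G\<^esub> \<alpha> y"
    and q: "q \<in> carrier G"
  obtains g :: "int poly \<Rightarrow> 'g" where "\<And>p. g p \<in> carrier G" "\<And>p p'. g (p + p') = g p \<oplus>\<^bsub>G\<^esub> g p'"
    "\<And>p. g ([:0, 1:] * p) = \<alpha> (g p)" "g 1 = q"
proof -
  interpret abelian_group G by (rule G)
  define g where "g p = foldr (\<lambda>c r. [c] \<cdot>\<^bsub>G\<^esub> q \<oplus>\<^bsub>G\<^esub> \<alpha> r) (coeffs p) \<zero>\<^bsub>G\<^esub>" for p :: "int poly"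
  have \<alpha>_closed: "\<alpha> x \<in> carrier G" if "x \<in> carrier G" for x
    using \<alpha>(1) that by blast
  have "\<alpha> \<zero>\<^bsub>G\<^esub> \<oplus>\<^bsub>G\<^esub> \<alpha> \<zero>\<^bsub>G\<^esub> = \<alpha> \<zero>\<^bsub>G\<^esub> \<oplus>\<^bsub>G\<^esub> \<zero>\<^bsub>G\<^esub>"
    using \<alpha>(2)[of "\<zero>\<^bsub>G\<^esub>" "\<zero>\<^bsub>G\<^esub>"] by (simp add: \<alpha>_closed)
  then have \<alpha>_zero: "\<alpha> \<zero>\<^bsub>G\<^esub> = \<zero>\<^bsub>G\<^esub>"
    by (simp add: \<alpha>_closed)
  have pow_closed: "[c] \<cdot>\<^bsub>G\<^esub> q \<in> carrier G" for c :: int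
    using q by simp
  have pow0: "[(0::int)] \<cdot>\<^bsub>G\<^esub> q = \<zero>\<^bsub>G\<^esub>" and pow1: "[(1::int)] \<cdot>\<^bsub>G\<^esub> q = q"
    using q by (simp_all add: add_pow_int_ge)
  \<comment> \<open>For \<open>c = 0\<close> and \<open>p = 0\<close> both coefficient lists are empty, and the equation holds because
      \<open>\<alpha>\<close> fixes zero.\<close>
  have g_pCons: "g (pCons c p) = [c] \<cdot>\<^bsub>G\<^esub> q \<oplus>\<^bsub>G\<^esub> \<alpha> (g p)" for c p
    by (cases "c = 0 \<and> p = 0") (auto simp: g_def cCons_def pow0 \<alpha>_zero)
  have g_zero: "g 0 = \<zero>\<^bsub>G\<^esub>"
    by (simp add: g_def)
  have g_closed: "g p \<in> carrier G" for p
    by (induction p) (simp_all add: g_zero g_pCons pow_closed \<alpha>_closed)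
  show ?thesis
  proof (rule that[of g])
    show "g (p + p') = g p \<oplus>\<^bsub>G\<^esub> g p'" for p p'
    proof (induction p p' rule: poly_induct2)
      case (pCons a p b p')
      have "g (pCons a p + pCons b p') =
          ([a] \<cdot>\<^bsub>G\<^esub> q \<oplus>\<^bsub>G\<^esub> [b] \<cdot>\<^bsub>G\<^esub> q) \<oplus>\<^bsub>G\<^esub> (\<alpha> (g p) \<oplus>\<^bsub>G\<^esub> \<alpha> (g p'))"
        by (simp add: g_pCons pCons \<alpha>(2) g_closed add.int_pow_mult q)
      also have "\<dots> = g (pCons a p) \<oplus>\<^bsub>G\<^esub> g (pCons b p')"
        by (simp add: g_pCons a_ac pow_closed \<alpha>_closed g_closed)
      finally show ?case .
    qed (simp add: g_zero)
    show "g ([:0, 1:] * p) = \<alpha> (g p)" for p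
      by (simp add: g_pCons pow0 \<alpha>_closed g_closed)
    show "g 1 = q"
      using q by (simp add: one_pCons g_pCons g_zero pow1 \<alpha>_zero)
  qed (rule g_closed)
qed

text \<open>
  The map \<open>x \<mapsto> x q\<close> has these properties whenever \<open>group_at e\<close> is a module over \<open>S\<close> on
  which \<open>s\<close> acts as the right translation by \<open>e\<close>.
\<close>
definition (in medial_latin_quandle) orbit_map :: "'k::comm_ring_1 set \<Rightarrow> 'k \<Rightarrow> 'a \<Rightarrow> 'a \<Rightarrow> ('k \<Rightarrow> 'a) \<Rightarrow> bool" where
  "orbit_map S s e q h \<longleftrightarrow> h \<in> S \<rightarrow> carrier Q \<and> h 1 = q \<and>
     (\<forall>x\<in>S. \<forall>y\<in>S. h (x + y) = h x \<oplus>\<^bsub>group_at e\<^esub> h y) \<and> (\<forall>x\<in>S. h (s * x) = h x \<star> e)"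

text \<open>
  A common power of \<open>t\<close> and \<open>1 - t\<close> can be reached by expanding the fraction, so inverting the single
  element \<open>t (1 - t)\<close> suffices.
\<close>
lemma carrier_LL:
  "carrier LL = {Fract p 1 / Fract ([:0, 1:] * [:1, -1:]) 1 ^ k | p k. True}" (is "_ = ?S")
proof -
  have pow: "Fract d 1 ^ k = Fract (d ^ k) 1" for d :: "int poly" and k
    by (induction k) (simp_all add: One_fract_def)
  have S: "?S = {Fract p ([:0, 1:] ^ k * [:1, -1:] ^ k) | p k. True}"
    by (simp add: pow power_mult_distrib del: mult_pCons_left mult_pCons_right)
  have "Fract p ([:0, 1:] ^ i * [:1, -1:] ^ j) =
    Fract (p * [:0, 1:] ^ j * [:1, -1:] ^ i) ([:0, 1:] ^ (i + j) * [:1, -1:] ^ (i + j))"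
    for p :: "int poly" and i j
    by (simp add: eq_fract power_add ac_simps del: mult_pCons_left mult_pCons_right)
  then show ?thesis
    unfolding S LL_def ring_on_def by simp blast
qed

lemma (in medial_latin_quandle) orbit_map_LL:
  assumes e: "e \<in> carrier Q" and q: "q \<in> carrier Q"
  shows "\<exists>h. orbit_map (carrier LL) LL_t e q h"
proof -
  let ?G = "group_at e" and ?d = "[:0, 1:] * [:1, -1:] :: int poly"
  let ?\<alpha> = "\<lambda>x. x \<star> e" and ?\<delta> = "\<lambda>x. e \<star> (x \<star> e)"
  interpret G: abelian_group ?G by (rule abelian_group_at[OF e])
  have \<alpha>: "?\<alpha> \<in> carrier ?G \<rightarrow> carrier ?G"
    using e by (simp add: closed)
  obtain g :: "int poly \<Rightarrow> 'a" where g: "\<And>p. g p \<in> carrier ?G"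
    "\<And>p p'. g (p + p') = g p \<oplus>\<^bsub>?G\<^esub> g p'" "\<And>p. g ([:0, 1:] * p) = ?\<alpha> (g p)" "g 1 = q"
    by (rule polynomial_orbit[OF abelian_group_at[OF e] \<alpha>, of q])
      (use e q translation_additive(1) in auto)
  \<comment> \<open>\<open>1 - t\<close> acts as the left translation by \<open>e\<close>: added to the action of \<open>t\<close>, either
      gives the identity, in \<open>Q\<close> because of idempotence.\<close>
  have g_minus: "g ([:1, -1:] * p) = e \<star> g p" for p
  proof (rule group_at_cancel[OF e])
    have "?\<alpha> (g p) \<oplus>\<^bsub>?G\<^esub> g ([:1, -1:] * p) = g ([:0, 1:] * p + [:1, -1:] * p)"
      by (simp only: g)
    also have "[:0, 1:] * p + [:1, -1:] * p = p"
    proof -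
      have "[:0, 1:] + [:1, -1:] = (1 :: int poly)" by (simp add: one_pCons)
      then show ?thesis by (simp only: distrib_right[symmetric] mult_1_left)
    qed
    also have "g p = ?\<alpha> (g p) \<oplus>\<^bsub>?G\<^esub> (e \<star> g p)"
      using op_eq_group_at[OF e, of "g p" "g p"] g(1) by (simp add: idem)
    finally show "?\<alpha> (g p) \<oplus>\<^bsub>?G\<^esub> g ([:1, -1:] * p) = ?\<alpha> (g p) \<oplus>\<^bsub>?G\<^esub> (e \<star> g p)" .
  qed (use g(1) e in \<open>auto simp: closed\<close>)
  have g_d: "g (?d * p) = ?\<delta> (g p)" for p
  proof -
    have "?d * p = [:1, -1:] * ([:0, 1:] * p)" by (simp only: mult_ac)
    then show ?thesis by (simp only: g_minus g(3))
  qed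
  obtain h where h: "h \<in> carrier LL \<rightarrow> carrier ?G" "\<And>p. h (Fract p 1) = g p"
    "\<And>x y. x \<in> carrier LL \<Longrightarrow> y \<in> carrier LL \<Longrightarrow> h (x + y) = h x \<oplus>\<^bsub>?G\<^esub> h y"
    "\<And>c \<alpha> x. \<alpha> \<in> carrier ?G \<rightarrow> carrier ?G \<Longrightarrow> (\<And>z. z \<in> carrier ?G \<Longrightarrow> \<alpha> (?\<delta> z) = ?\<delta> (\<alpha> z)) \<Longrightarrow>
       (\<And>p. g (c * p) = \<alpha> (g p)) \<Longrightarrow> x \<in> carrier LL \<Longrightarrow> h (Fract c 1 * x) = \<alpha> (h x)"
  proof (rule extend_to_localization[of "\<lambda>p. Fract p 1" ?d g ?G ?\<delta>, folded carrier_LL])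
    show "?\<delta> (x \<oplus>\<^bsub>?G\<^esub> y) = ?\<delta> x \<oplus>\<^bsub>?G\<^esub> ?\<delta> y" if "x \<in> carrier ?G" "y \<in> carrier ?G" for x y
      using that e by (simp add: translation_additive closed)
    show "bij_betw ?\<delta> (carrier ?G) (carrier ?G)"
      using bij_betw_trans[OF right_translation_bij[OF e] latin[OF e]] by (simp add: comp_def)
    show "inj (\<lambda>p::int poly. Fract p 1)"
      by (auto simp: inj_def eq_fract)
    show "Fract ?d 1 \<noteq> 0"
      by (simp add: Zero_fract_def eq_fract)
  qed (use g g_d abelian_group_at[OF e] in \<open>auto simp: One_fract_def simp del: mult_pCons_left\<close>)
  have "orbit_map (carrier LL) LL_t e q h"
    unfolding orbit_map_def
  proof (intro conjI ballI)
    show "h 1 = q"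
      using h(2)[of 1] g(4) by (simp add: One_fract_def)
    show "h (LL_t * x) = h x \<star> e" if "x \<in> carrier LL" for x
      unfolding LL_t_def
      by (rule h(4)) (use that \<alpha> g e in \<open>auto simp: closed translation_distrib(3)[symmetric]\<close>)
  qed (use h in auto)
  then show ?thesis by blast
qed

lemma carrier_DD: "carrier DD = {of_int a / of_int 2 ^ k | a k. True}"
  by (simp add: DD_def ring_on_def)

lemma (in medial_commutative_quandle) orbit_map_DD:
  assumes e: "e \<in> carrier Q" and q: "q \<in> carrier Q"
  shows "\<exists>h. medial_latin_quandle.orbit_map Q (carrier DD) (1 / 2) e q h"
proof -
  interpret medial_latin_quandle Q by (rule medial_latin)
  let ?G = "group_at e"
  let ?\<delta> = "\<lambda>x. rdiv x e"
  interpret G: abelian_group ?G by (rule abelian_group_at[OF e])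
  have \<delta>_closed: "?\<delta> \<in> carrier ?G \<rightarrow> carrier ?G"
    using e by simp
  \<comment> \<open>Left and right division by \<open>e\<close> agree, so \<open>x \<oplus> x = (x / e) \<star> (x / e) = x / e\<close>: the
      translations by \<open>e\<close> halve.\<close>
  have double: "x \<oplus>\<^bsub>?G\<^esub> x = ?\<delta> x" if "x \<in> carrier Q" for x
  proof -
    have "ldiv e x = rdiv x e"
      by (rule left_cancel[OF e]) (use e that commutative[OF e] in auto)
    then show ?thesis
      using e that by (simp add: group_at_add idem)
  qed
  define g where "g a = [a] \<cdot>\<^bsub>?G\<^esub> q" for a :: int
  have g: "g a \<in> carrier ?G" "g (a + b) = g a \<oplus>\<^bsub>?G\<^esub> g b" "g 1 = q" for a b
    using q by (simp_all add: g_def G.add.int_pow_mult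
      G.add.int_pow_closed[simplified] G.add.int_pow_1[simplified])
  have g_double: "g (2 * a) = ?\<delta> (g a)" for a
    using g(2)[of a a] double[of "g a"] g(1) by simp
  obtain h where h: "h \<in> carrier DD \<rightarrow> carrier ?G" "\<And>a. h (of_int a) = g a"
    "\<And>x y. x \<in> carrier DD \<Longrightarrow> y \<in> carrier DD \<Longrightarrow> h (x + y) = h x \<oplus>\<^bsub>?G\<^esub> h y"
    "\<And>c \<alpha> x. \<alpha> \<in> carrier ?G \<rightarrow> carrier ?G \<Longrightarrow> (\<And>z. z \<in> carrier ?G \<Longrightarrow> \<alpha> (?\<delta> z) = ?\<delta> (\<alpha> z)) \<Longrightarrow>
       (\<And>p. g (c * p) = \<alpha> (g p)) \<Longrightarrow> x \<in> carrier DD \<Longrightarrow> h (of_int c * x) = \<alpha> (h x)"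
  proof (rule extend_to_localization[of "of_int :: int \<Rightarrow> rat" 2 g ?G ?\<delta>, folded carrier_DD])
    show "bij_betw ?\<delta> (carrier ?G) (carrier ?G)"
      using bij_betw_inv_into[OF right_translation_bij[OF e]] by (simp add: rdiv_def)
    show "?\<delta> (x \<oplus>\<^bsub>?G\<^esub> y) = ?\<delta> x \<oplus>\<^bsub>?G\<^esub> ?\<delta> y" if "x \<in> carrier ?G" "y \<in> carrier ?G" for x y
      using that e by (simp add: group_at_add division_distrib)
    show "inj (of_int :: int \<Rightarrow> rat)"
      by (simp add: inj_def)
  qed (use g g_double abelian_group_at[OF e] in auto)
  have "orbit_map (carrier DD) (1 / 2) e q h"
    unfolding orbit_map_def
  proof (intro conjI ballI)
    show "h 1 = q"
      using h(2)[of 1] g(3) by simp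
    show "h (1 / 2 * x) = h x \<star> e" if x: "x \<in> carrier DD" for x
    proof -
      have half: "1 / 2 * x \<in> carrier DD"
      proof -
        from x obtain a k where "x = of_int a / 2 ^ k"
          by (auto simp: carrier_DD)
        then have "1 / 2 * x = of_int a / of_int 2 ^ Suc k" by simp
        then show ?thesis unfolding carrier_DD by blast
      qed
      have "h (of_int 2 * (1 / 2 * x)) = ?\<delta> (h (1 / 2 * x))"
        by (rule h(4)) (use half g_double \<delta>_closed in auto)
      then have "h x = ?\<delta> (h (1 / 2 * x))" by simp
      then show ?thesis using rdiv_cancel(1)[OF e, of "h (1 / 2 * x)"] h(1) half by (auto simp: Pi_iff)
    qed
  qed (use h in auto)
  then show ?thesis by blast
qed

section \<open>The quandle on a power of the scalars and its affine frame\<close>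

text \<open>
  The two quandles of the theorem differ only in the scalars. The operation of the first one contains
  the additive inverse of a module, which the group laws determine on the carrier only, so the
  quandle \<open>A\<close> is a parameter specified by its behaviour there. The assumption \<open>generated\<close> says that \<open>S\<close> is the smallest additive group containing \<open>1\<close>
  and stable under \<open>s\<close>, \<open>1/s\<close> and \<open>1/(1 - s)\<close>.
\<close>
locale affine_power_quandle =
  fixes S :: "'k::field set" and s :: 'k and k :: nat and A :: "(nat \<Rightarrow> 'k) magma"
  assumes one_mem: "1 \<in> S" and s_mem: "s \<in> S" and inverse_mem: "1 / s \<in> S" "1 / (1 - s) \<in> S"
    and diff_mem: "x \<in> S \<Longrightarrow> y \<in> S \<Longrightarrow> x - y \<in> S"
    and mult_mem: "x \<in> S \<Longrightarrow> y \<in> S \<Longrightarrow> x * y \<in> S"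
    and nonzero: "s \<noteq> 0" "s \<noteq> 1"
    and generated: "\<lbrakk>1 \<in> T; \<And>x y. x \<in> T \<Longrightarrow> y \<in> T \<Longrightarrow> x - y \<in> T; \<And>x. x \<in> T \<Longrightarrow> s * x \<in> T;
      \<And>x. x \<in> T \<Longrightarrow> (1 / s) * x \<in> T; \<And>x. x \<in> T \<Longrightarrow> (1 / (1 - s)) * x \<in> T\<rbrakk> \<Longrightarrow> S \<subseteq> T"
    and carrier_A: "carrier A = {..<k} \<rightarrow>\<^sub>E S"
    and op_A: "\<lbrakk>v \<in> carrier A; w \<in> carrier A\<rbrakk> \<Longrightarrow> v \<star>\<^bsub>A\<^esub> w = (\<lambda>i\<in>{..<k}. s * v i + (1 - s) * w i)"
begin

lemma zero_mem: "0 \<in> S"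
  using diff_mem[OF one_mem one_mem] by simp

lemma add_mem: "x \<in> S \<Longrightarrow> y \<in> S \<Longrightarrow> x + y \<in> S"
  using diff_mem[OF _ diff_mem[OF zero_mem, of y], of x] by simp

lemma divide_mem: "x \<in> S \<Longrightarrow> x / s \<in> S" "x \<in> S \<Longrightarrow> x / (1 - s) \<in> S"
  using mult_mem[OF inverse_mem(1), of x] mult_mem[OF inverse_mem(2), of x] by simp_all

lemmas mem = one_mem zero_mem s_mem inverse_mem diff_mem add_mem mult_mem divide_mem

lemma restrict_mem: "(\<And>i. i < k \<Longrightarrow> v i \<in> S) \<Longrightarrow> (\<lambda>i\<in>{..<k}. v i) \<in> carrier A"
  by (simp add: carrier_A)

lemma coord_mem: "v \<in> carrier A \<Longrightarrow> i < k \<Longrightarrow> v i \<in> S"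
  by (auto simp: carrier_A)

lemma vector_eqI: "v \<in> carrier A \<Longrightarrow> w \<in> carrier A \<Longrightarrow> (\<And>i. i < k \<Longrightarrow> v i = w i) \<Longrightarrow> v = w"
  unfolding carrier_A by (rule PiE_ext) auto

lemma op_closed: "v \<in> carrier A \<Longrightarrow> w \<in> carrier A \<Longrightarrow> v \<star>\<^bsub>A\<^esub> w \<in> carrier A"
  by (simp add: op_A restrict_mem mem coord_mem)

lemma op_coord: "v \<in> carrier A \<Longrightarrow> w \<in> carrier A \<Longrightarrow> i < k \<Longrightarrow> (v \<star>\<^bsub>A\<^esub> w) i = s * v i + (1 - s) * w i"
  by (simp add: op_A)

lemma medial_latin: "medial_latin_quandle A"
proof
  fix u assume u: "u \<in> carrier A"
  have "bij_betw (\<lambda>v. v \<star>\<^bsub>A\<^esub> u) (carrier A) (carrier A)"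
    by (rule bij_betw_byWitness[where f' = "\<lambda>v. \<lambda>i\<in>{..<k}. (v i - (1 - s) * u i) / s"])
      (use u in \<open>auto intro!: vector_eqI op_closed restrict_mem
        simp: op_coord restrict_mem mem coord_mem op_closed nonzero\<close>)
  moreover have "(v \<star>\<^bsub>A\<^esub> w) \<star>\<^bsub>A\<^esub> u = (v \<star>\<^bsub>A\<^esub> u) \<star>\<^bsub>A\<^esub> (w \<star>\<^bsub>A\<^esub> u)"
    if "v \<in> carrier A" "w \<in> carrier A" for v w
    by (rule vector_eqI) (use u that in \<open>simp_all add: op_closed op_coord algebra_simps\<close>)
  ultimately show "(\<lambda>v. v \<star>\<^bsub>A\<^esub> u) \<in> magma_iso A A"
    using u by (simp add: magma_iso_def magma_hom_def op_closed)
  show "bij_betw (\<lambda>v. u \<star>\<^bsub>A\<^esub> v) (carrier A) (carrier A)"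
    by (rule bij_betw_byWitness[where f' = "\<lambda>v. \<lambda>i\<in>{..<k}. (v i - s * u i) / (1 - s)"])
      (use u in \<open>auto intro!: vector_eqI op_closed restrict_mem
        simp: op_coord restrict_mem mem coord_mem op_closed nonzero\<close>)
  show "u \<star>\<^bsub>A\<^esub> u = u"
    by (rule vector_eqI) (use u in \<open>simp_all add: op_closed op_coord algebra_simps\<close>)
next
  fix a b c d assume "a \<in> carrier A" "b \<in> carrier A" "c \<in> carrier A" "d \<in> carrier A"
  then show "(a \<star>\<^bsub>A\<^esub> b) \<star>\<^bsub>A\<^esub> (c \<star>\<^bsub>A\<^esub> d) = (a \<star>\<^bsub>A\<^esub> c) \<star>\<^bsub>A\<^esub> (b \<star>\<^bsub>A\<^esub> d)"
    by (intro vector_eqI) (simp_all add: op_closed op_coord algebra_simps)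
qed (rule op_closed)

lemma medial_commutative:
  assumes "s = 1 / 2"
  shows "medial_commutative_quandle A"
proof -
  interpret medial_latin_quandle A by (rule medial_latin)
  show ?thesis
  proof
    fix v w assume "v \<in> carrier A" "w \<in> carrier A"
    then show "v \<star>\<^bsub>A\<^esub> w = w \<star>\<^bsub>A\<^esub> v"
      by (intro vector_eqI) (use nonzero in \<open>simp_all add: op_closed op_coord assms field_simps\<close>)
  qed
qed

text \<open>
  For \<open>i < k\<close> this is a unit vector. The condition \<open>l = i\<close> never holds when \<open>i = k\<close>, so
  \<open>frame k\<close> is the origin.
\<close>
definition frame :: "nat \<Rightarrow> nat \<Rightarrow> 'k" where
  "frame i = (\<lambda>l\<in>{..<k}. if l = i then 1 else 0)"

lemma frame_mem: "frame i \<in> carrier A"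
  unfolding frame_def by (rule restrict_mem) (simp add: mem)

lemma frame_coord: "l < k \<Longrightarrow> frame i l = (if l = i then 1 else 0)"
  by (simp add: frame_def)

lemma inj_on_frame: "inj_on frame {..k}"
proof (rule inj_onI)
  fix i i' assume i: "i \<in> {..k}" "i' \<in> {..k}" and "frame i = frame i'"
  then have "frame i l = frame i' l" for l by simp
  from this[of i] this[of i'] i show "i = i'"
    by (cases "i = k"; cases "i' = k") (auto simp: frame_coord split: if_splits)
qed

text \<open>
  Translating by the origin multiplies a vector by \<open>s\<close> or by \<open>1 - s\<close>, and dividing by it multiplies
  by the inverses. This recovers the sum of \<open>v\<close> and \<open>w\<close> as \<open>(v / s) \<star> (w / (1 - s))\<close>, and
  the module structure with it.
\<close>
lemma frame_generates:
  assumes E: "E \<subseteq> carrier A" "\<And>i. i \<le> k \<Longrightarrow> frame i \<in> E"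
    and op: "\<And>v w. v \<in> E \<Longrightarrow> w \<in> E \<Longrightarrow> v \<star>\<^bsub>A\<^esub> w \<in> E"
    and ldiv: "\<And>v w. v \<in> E \<Longrightarrow> w \<in> carrier A \<Longrightarrow> v \<star>\<^bsub>A\<^esub> w \<in> E \<Longrightarrow> w \<in> E"
    and rdiv: "\<And>v w. v \<in> carrier A \<Longrightarrow> w \<in> E \<Longrightarrow> v \<star>\<^bsub>A\<^esub> w \<in> E \<Longrightarrow> v \<in> E"
  shows "E = carrier A"
proof -
  let ?smul = "\<lambda>c v. \<lambda>i\<in>{..<k}. c * v i"
  have EA: "v \<in> carrier A" if "v \<in> E" for v
    using that E(1) by blast
  have smul_A: "?smul c v \<in> carrier A" if "c \<in> S" "v \<in> carrier A" for c v
    by (rule restrict_mem) (use that in \<open>auto intro: mult_mem coord_mem\<close>)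
  have origin: "frame k \<in> E"
    using E(2) by simp
  have origin_coord: "frame k i = 0" if "i < k" for i
    using that by (simp add: frame_coord)
  have scale: "?smul s v = v \<star>\<^bsub>A\<^esub> frame k" "?smul (1 - s) v = frame k \<star>\<^bsub>A\<^esub> v" if "v \<in> carrier A" for v
    using that by (auto intro!: vector_eqI smul_A mem op_closed frame_mem simp: op_coord frame_mem origin_coord)
  have unscale: "?smul (1 / s) v \<star>\<^bsub>A\<^esub> frame k = v" "frame k \<star>\<^bsub>A\<^esub> ?smul (1 / (1 - s)) v = v"
    if "v \<in> carrier A" for v
    using that by (auto intro!: vector_eqI restrict_mem op_closed frame_mem
        simp: op_coord frame_mem origin_coord nonzero restrict_mem mem coord_mem)
  have E_s: "?smul s v \<in> E" if "v \<in> E" for v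
    using that op[OF that origin] by (simp add: scale EA)
  have E_inv: "?smul (1 / s) v \<in> E" "?smul (1 / (1 - s)) v \<in> E" if "v \<in> E" for v
    using rdiv[of "?smul (1 / s) v" "frame k"] ldiv[of "frame k" "?smul (1 / (1 - s)) v"]
      that origin unscale[OF EA[OF that]] smul_A[OF inverse_mem(1) EA[OF that]]
      smul_A[OF inverse_mem(2) EA[OF that]] by simp_all
  have sum_eq: "?smul (1 / s) v \<star>\<^bsub>A\<^esub> ?smul (1 / (1 - s)) w = (\<lambda>i\<in>{..<k}. v i + w i)"
    if "v \<in> carrier A" "w \<in> carrier A" for v w
    using that by (auto intro!: vector_eqI restrict_mem op_closed
        simp: op_coord restrict_mem mem coord_mem nonzero)
  have E_add: "(\<lambda>i\<in>{..<k}. v i + w i) \<in> E" if "v \<in> E" "w \<in> E" for v w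
    using op[OF E_inv(1)[OF that(1)] E_inv(2)[OF that(2)]] sum_eq[OF EA EA, OF that] by simp
  have E_minus: "?smul (- 1) v \<in> E" if "v \<in> E" for v
  proof -
    have "- 1 \<in> S" using diff_mem[OF zero_mem one_mem] by simp
    then have neg: "?smul (- 1) v \<in> carrier A"
      by (rule smul_A) (rule EA[OF that])
    let ?w = "?smul (1 / (1 - s)) (?smul (- 1) v)"
    have w: "?w \<in> carrier A"
      by (rule smul_A[OF inverse_mem(2) neg])
    \<comment> \<open>\<open>v + (- v) = 0\<close> is a product with value and left factor in \<open>E\<close>, hence so is its right
        factor.\<close>
    have "?smul (1 / s) v \<star>\<^bsub>A\<^esub> ?w = frame k"
      unfolding sum_eq[OF EA[OF that] neg] by (auto simp: frame_def)
    then have "?w \<in> E"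
      using ldiv[OF E_inv(1)[OF that] w] origin by simp
    then have "frame k \<star>\<^bsub>A\<^esub> ?w \<in> E"
      by (rule op[OF origin])
    then show ?thesis
      unfolding unscale(2)[OF neg] .
  qed
  have E_ray: "?smul c (frame i) \<in> E" if "c \<in> S" "i < k" for c i
  proof -
    have "S \<subseteq> {c. ?smul c (frame i) \<in> E}" (is "_ \<subseteq> ?T")
    proof (rule generated)
      have "?smul 1 (frame i) = frame i"
        by (auto simp: frame_def)
      then show "1 \<in> ?T"
        using E(2)[of i] that by simp
      have smul_smul: "?smul a (?smul b v) = ?smul (a * b) v" for a b and v :: "nat \<Rightarrow> 'k"
        by auto
      fix x assume x: "x \<in> ?T"
      then have xE: "?smul x (frame i) \<in> E" by simp
      show "s * x \<in> ?T" "1 / s * x \<in> ?T" "1 / (1 - s) * x \<in> ?T"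
        using E_s[OF xE] E_inv[OF xE] unfolding smul_smul by blast+
      fix y assume "y \<in> ?T"
      then have "?smul y (frame i) \<in> E" by simp
      from E_add[OF xE E_minus[OF this]]
      have "(\<lambda>l\<in>{..<k}. ?smul x (frame i) l + ?smul (- 1) (?smul y (frame i)) l) \<in> E" .
      also have "(\<lambda>l\<in>{..<k}. ?smul x (frame i) l + ?smul (- 1) (?smul y (frame i)) l) =
          ?smul (x - y) (frame i)"
        by (auto simp: algebra_simps)
      finally show "x - y \<in> ?T" by (rule CollectI)
    qed
    then show ?thesis using that by blast
  qed
  have "v \<in> E" if v: "v \<in> carrier A" for v
  proof -
    \<comment> \<open>Vectors supported on the first \<open>m\<close> coordinates, adding one coordinate at a time.\<close>
    have "(\<lambda>i\<in>{..<k}. if i < m then v i else 0) \<in> E" if "m \<le> k" for m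
      using that
    proof (induction m)
      case 0
      then show ?case using origin by (simp add: frame_def restrict_def cong: if_cong)
    next
      case (Suc m)
      have "(\<lambda>i\<in>{..<k}. if i < Suc m then v i else 0) =
        (\<lambda>i\<in>{..<k}. (\<lambda>i\<in>{..<k}. if i < m then v i else 0) i + ?smul (v m) (frame m) i)"
        using Suc.prems by (auto simp: frame_def less_Suc_eq)
      also have "\<dots> \<in> E"
        using Suc.prems by (intro E_add Suc.IH E_ray coord_mem[OF v]) simp_all
      finally show ?case .
    qed
    from this[of k] have "(\<lambda>i\<in>{..<k}. if i < k then v i else 0) \<in> E" by simp
    moreover have "(\<lambda>i\<in>{..<k}. if i < k then v i else 0) = v"
      by (rule vector_eqI, rule restrict_mem) (simp_all add: v coord_mem[OF v])
    ultimately show ?thesis by simp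
  qed
  then show ?thesis using E(1) by blast
qed

text \<open>
  The set where \<open>h\<close> and \<open>h'\<close> agree is closed under both divisions because translations of \<open>Q\<close> are
  injective.
\<close>
lemma hom_unique:
  assumes Q: "medial_latin_quandle Q" and h: "h \<in> magma_hom A Q" "h' \<in> magma_hom A Q"
    and eq: "\<And>i. i \<le> k \<Longrightarrow> h (frame i) = h' (frame i)" and v: "v \<in> carrier A"
  shows "h v = h' v"
proof -
  interpret medial_latin_quandle Q by (rule Q)
  have hQ: "h v \<in> carrier Q" "h' v \<in> carrier Q" if "v \<in> carrier A" for v
    using that h by (auto simp: magma_hom_def)
  have h_op: "h (v \<star>\<^bsub>A\<^esub> w) = h v \<star>\<^bsub>Q\<^esub> h w" "h' (v \<star>\<^bsub>A\<^esub> w) = h' v \<star>\<^bsub>Q\<^esub> h' w"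
    if "v \<in> carrier A" "w \<in> carrier A" for v w
    using that h by (auto simp: magma_hom_def)
  have "{v \<in> carrier A. h v = h' v} = carrier A"
  proof (rule frame_generates)
    fix v w assume "v \<in> {v \<in> carrier A. h v = h' v}" "w \<in> carrier A" "v \<star>\<^bsub>A\<^esub> w \<in> {v \<in> carrier A. h v = h' v}"
    then show "w \<in> {v \<in> carrier A. h v = h' v}"
      using left_cancel[of "h v" "h w" "h' w"] by (simp add: hQ h_op)
  next
    fix v w assume "v \<in> carrier A" "w \<in> {v \<in> carrier A. h v = h' v}" "v \<star>\<^bsub>A\<^esub> w \<in> {v \<in> carrier A. h v = h' v}"
    then show "v \<in> {v \<in> carrier A. h v = h' v}"
      using right_cancel[of "h w" "h v" "h' v"] by (simp add: hQ h_op)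
  qed (use eq in \<open>auto simp: frame_mem op_closed h_op\<close>)
  then show ?thesis using v by blast
qed

text \<open>
  With \<open>e\<close> as zero of the group on \<open>Q\<close>, the homomorphism is the linear map
  \<open>v \<mapsto> \<Sum>\<^sub>i g\<^sub>i (v\<^sub>i)\<close>, where \<open>g\<^sub>i\<close> is the orbit map of \<open>q i\<close>. It preserves \<open>\<star>\<close> because \<open>s\<close>
  acts as right and \<open>1 - s\<close> as left translation by \<open>e\<close>, and \<open>x \<star> y = (x \<star> e) \<oplus> (e \<star> y)\<close>.
\<close>
lemma hom_exists:
  assumes Q: "medial_latin_quandle Q" and e: "e \<in> carrier Q" and q: "\<And>i. i < k \<Longrightarrow> q i \<in> carrier Q"
    and orbit: "\<And>p. p \<in> carrier Q \<Longrightarrow> \<exists>h. medial_latin_quandle.orbit_map Q S s e p h"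
  obtains H where "H \<in> magma_hom A Q" "H (frame k) = e" "\<And>i. i < k \<Longrightarrow> H (frame i) = q i"
proof -
  interpret medial_latin_quandle Q by (rule Q)
  let ?G = "group_at e"
  interpret G: abelian_group ?G by (rule abelian_group_at[OF e])
  have "\<forall>i. \<exists>h. i < k \<longrightarrow> orbit_map S s e (q i) h"
    using orbit q by blast
  then obtain g where g: "\<And>i. i < k \<Longrightarrow> orbit_map S s e (q i) (g i)"
    by metis
  have g_closed: "g i x \<in> carrier Q" if "i < k" "x \<in> S" for i x
    using g[OF that(1)] that by (auto simp: orbit_map_def)
  have g_add: "g i (x + y) = g i x \<oplus>\<^bsub>?G\<^esub> g i y" if "i < k" "x \<in> S" "y \<in> S" for i x y
    using g[OF that(1)] that by (auto simp: orbit_map_def)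
  have g_s: "g i (s * x) = g i x \<star>\<^bsub>Q\<^esub> e" if "i < k" "x \<in> S" for i x
    using g[OF that(1)] that by (auto simp: orbit_map_def)
  have g_one: "g i 1 = q i" if "i < k" for i
    using g[OF that] by (auto simp: orbit_map_def)
  have g_zero: "g i 0 = e" if "i < k" for i
    using group_at_cancel[OF e, of "g i 0" "g i 0" e] g_add[OF that, of 0 0] g_closed[OF that zero_mem] e
      G.r_zero[of "g i 0"] zero_mem by simp
  have g_1s: "g i ((1 - s) * x) = e \<star>\<^bsub>Q\<^esub> g i x" if "i < k" "x \<in> S" for i x
  proof (rule group_at_cancel[OF e])
    have "(g i x \<star>\<^bsub>Q\<^esub> e) \<oplus>\<^bsub>?G\<^esub> g i ((1 - s) * x) = g i (s * x + (1 - s) * x)"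
      using that by (simp add: g_add g_s mem)
    also have "\<dots> = (g i x \<star>\<^bsub>Q\<^esub> e) \<oplus>\<^bsub>?G\<^esub> (e \<star>\<^bsub>Q\<^esub> g i x)"
      using op_eq_group_at[OF e, of "g i x" "g i x"] g_closed that by (simp add: idem algebra_simps)
    finally show "(g i x \<star>\<^bsub>Q\<^esub> e) \<oplus>\<^bsub>?G\<^esub> g i ((1 - s) * x) = (g i x \<star>\<^bsub>Q\<^esub> e) \<oplus>\<^bsub>?G\<^esub> (e \<star>\<^bsub>Q\<^esub> g i x)" .
  qed (use that g_closed e in \<open>auto simp: closed mem\<close>)
  have sum_translation: "(\<Oplus>\<^bsub>?G\<^esub>i\<in>I. u i) \<star>\<^bsub>Q\<^esub> e = (\<Oplus>\<^bsub>?G\<^esub>i\<in>I. u i \<star>\<^bsub>Q\<^esub> e)"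
    "e \<star>\<^bsub>Q\<^esub> (\<Oplus>\<^bsub>?G\<^esub>i\<in>I. u i) = (\<Oplus>\<^bsub>?G\<^esub>i\<in>I. e \<star>\<^bsub>Q\<^esub> u i)"
    if "finite I" "u \<in> I \<rightarrow> carrier Q" for I :: "nat set" and u
  proof -
    have "(\<Oplus>\<^bsub>?G\<^esub>i\<in>I. u i) \<star>\<^bsub>Q\<^esub> e = (\<Oplus>\<^bsub>?G\<^esub>i\<in>I. u i \<star>\<^bsub>Q\<^esub> e) \<and>
      e \<star>\<^bsub>Q\<^esub> (\<Oplus>\<^bsub>?G\<^esub>i\<in>I. u i) = (\<Oplus>\<^bsub>?G\<^esub>i\<in>I. e \<star>\<^bsub>Q\<^esub> u i)"
      using that
    proof (induction I rule: finite_induct)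
      case empty
      then show ?case using e by (simp add: idem)
    next
      case (insert i I)
      moreover have "(\<Oplus>\<^bsub>?G\<^esub>i\<in>I. u i) \<in> carrier Q"
        using G.finsum_closed[of u I] insert.prems by auto
      ultimately show ?case
        using e by (simp add: Pi_iff closed translation_additive)
    qed
    then show "(\<Oplus>\<^bsub>?G\<^esub>i\<in>I. u i) \<star>\<^bsub>Q\<^esub> e = (\<Oplus>\<^bsub>?G\<^esub>i\<in>I. u i \<star>\<^bsub>Q\<^esub> e)"
      "e \<star>\<^bsub>Q\<^esub> (\<Oplus>\<^bsub>?G\<^esub>i\<in>I. u i) = (\<Oplus>\<^bsub>?G\<^esub>i\<in>I. e \<star>\<^bsub>Q\<^esub> u i)" by auto
  qed
  define H where "H v = (\<Oplus>\<^bsub>?G\<^esub>i\<in>{..<k}. g i (v i))" for v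
  have H_closed: "H v \<in> carrier Q" if "v \<in> carrier A" for v
    unfolding H_def using G.finsum_closed[of "\<lambda>i. g i (v i)" "{..<k}"] that g_closed coord_mem by auto
  have H_op: "H (v \<star>\<^bsub>A\<^esub> w) = H v \<star>\<^bsub>Q\<^esub> H w" if v: "v \<in> carrier A" and w: "w \<in> carrier A" for v w
  proof -
    have "H (v \<star>\<^bsub>A\<^esub> w) = (\<Oplus>\<^bsub>?G\<^esub>i\<in>{..<k}. (g i (v i) \<star>\<^bsub>Q\<^esub> e) \<oplus>\<^bsub>?G\<^esub> (e \<star>\<^bsub>Q\<^esub> g i (w i)))"
      unfolding H_def using v w e
      by (intro G.add.finprod_cong')
        (auto simp: op_coord coord_mem mem g_add g_s g_1s g_closed closed intro!: G.a_closed[simplified])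
    also have "\<dots> = (\<Oplus>\<^bsub>?G\<^esub>i\<in>{..<k}. g i (v i) \<star>\<^bsub>Q\<^esub> e) \<oplus>\<^bsub>?G\<^esub> (\<Oplus>\<^bsub>?G\<^esub>i\<in>{..<k}. e \<star>\<^bsub>Q\<^esub> g i (w i))"
      using v w e by (intro G.finsum_addf) (auto simp: coord_mem g_closed closed)
    also have "\<dots> = (H v \<star>\<^bsub>Q\<^esub> e) \<oplus>\<^bsub>?G\<^esub> (e \<star>\<^bsub>Q\<^esub> H w)"
      using sum_translation(1)[of "{..<k}" "\<lambda>i. g i (v i)"] v
        sum_translation(2)[of "{..<k}" "\<lambda>i. g i (w i)"] w
      by (simp add: H_def coord_mem g_closed Pi_iff)
    also have "\<dots> = H v \<star>\<^bsub>Q\<^esub> H w"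
      using op_eq_group_at[OF e H_closed[OF v] H_closed[OF w]] by simp
    finally show ?thesis .
  qed
  have H_frame: "H (frame i) = (\<Oplus>\<^bsub>?G\<^esub>l\<in>{..<k}. if i = l then q l else \<zero>\<^bsub>?G\<^esub>)" for i
    unfolding H_def
    by (intro G.add.finprod_cong') (auto simp: frame_def g_one g_zero q e)
  show ?thesis
  proof (rule that[of H])
    show "H \<in> magma_hom A Q"
      using H_closed H_op by (auto simp: magma_hom_def)
    have "H (frame k) = (\<Oplus>\<^bsub>?G\<^esub>l\<in>{..<k}. \<zero>\<^bsub>?G\<^esub>)"
      unfolding H_frame by (intro G.add.finprod_cong') (use e in auto)
    also have "\<dots> = \<zero>\<^bsub>?G\<^esub>" by (rule G.finsum_zero)
    finally show "H (frame k) = e" by simp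
    show "H (frame i) = q i" if "i < k" for i
      unfolding H_frame using that q by (intro G.finsum_singleton) auto
  qed
qed

lemma universal_for_frame:
  fixes P :: "'q magma \<Rightarrow> bool"
  assumes b: "bij_betw b X {..k}"
    and P: "\<And>Q. P Q \<Longrightarrow> medial_latin_quandle Q"
    and orbit: "\<And>Q e p. P Q \<Longrightarrow> e \<in> carrier Q \<Longrightarrow> p \<in> carrier Q \<Longrightarrow>
      \<exists>h. medial_latin_quandle.orbit_map Q S s e p h"
  shows "universal_for P X A (frame \<circ> b)"
  unfolding universal_for_def
proof (intro allI impI ballI)
  fix Q f assume PQ: "P Q" and f: "f \<in> X \<rightarrow> carrier Q"
  define q where "q i = f (inv_into X b i)" for i
  have q: "q i \<in> carrier Q" if "i \<le> k" for i
    using f b that unfolding q_def by (metis Pi_mem atMost_iff bij_betw_def inv_into_into)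
  have qb: "q (b x) = f x" "b x \<le> k" if "x \<in> X" for x
    using bij_betw_inv_into_left[OF b that] bij_betwE[OF b] that by (auto simp: q_def)
  obtain H where H: "H \<in> magma_hom A Q" "H (frame k) = q k" "\<And>i. i < k \<Longrightarrow> H (frame i) = q i"
    by (rule hom_exists[OF P[OF PQ], of "q k" q]) (use q orbit[OF PQ] in auto)
  have H_frame: "H (frame i) = q i" if "i \<le> k" for i
    using H(2,3) that by (cases "i = k") auto
  show "\<exists>!h. h \<in> magma_hom A Q \<and> h \<in> extensional (carrier A) \<and> (\<forall>x\<in>X. h ((frame \<circ> b) x) = f x)"
  proof (rule ex1I[of _ "restrict H (carrier A)"])
    show "restrict H (carrier A) \<in> magma_hom A Q \<and> restrict H (carrier A) \<in> extensional (carrier A) \<and>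
      (\<forall>x\<in>X. restrict H (carrier A) ((frame \<circ> b) x) = f x)"
      using H(1) by (auto simp: magma_hom_def op_closed frame_mem H_frame qb)
  next
    fix h assume h: "h \<in> magma_hom A Q \<and> h \<in> extensional (carrier A) \<and> (\<forall>x\<in>X. h ((frame \<circ> b) x) = f x)"
    have "h (frame i) = q i" if "i \<le> k" for i
    proof -
      obtain x where "x \<in> X" "b x = i"
        using b \<open>i \<le> k\<close> by (metis atMost_iff bij_betw_imp_surj_on imageE)
      then show ?thesis using h qb(1) by auto
    qed
    then have "h v = H v" if "v \<in> carrier A" for v
      using hom_unique[OF P[OF PQ], of h H] h H(1) H_frame that by auto
    then show "h = restrict H (carrier A)"
      using h by (auto simp: fun_eq_iff extensional_def)
  qed
qed

end

text \<open>
  The extensions of \<open>\<kappa>\<close> and \<open>\<iota>\<close> are mutually inverse, since their composites and the identities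
  extend the same map. The two classes of test objects are separate parameters because they live on
  different types.
\<close>
lemma universal_unique:
  fixes F :: "'f magma" and A :: "'a magma"
    and PF :: "'f magma \<Rightarrow> bool" and PA :: "'a magma \<Rightarrow> bool"
  assumes "PF F" "PA A" and \<iota>: "\<iota> \<in> X \<rightarrow> carrier F" and \<kappa>: "\<kappa> \<in> X \<rightarrow> carrier A"
    and closed: "magma F" "magma A"
    and F: "universal_for PF X F \<iota>" "universal_for PA X F \<iota>"
    and A: "universal_for PF X A \<kappa>" "universal_for PA X A \<kappa>"
  shows "F \<cong>\<^sub>m A"
proof -
  obtain h where h: "h \<in> magma_hom F A" "\<And>x. x \<in> X \<Longrightarrow> h (\<iota> x) = \<kappa> x"
    using F(2) \<open>PA A\<close> \<kappa> unfolding universal_for_def by blast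
  obtain h' where h': "h' \<in> magma_hom A F" "\<And>x. x \<in> X \<Longrightarrow> h' (\<kappa> x) = \<iota> x"
    using A(1) \<open>PF F\<close> \<iota> unfolding universal_for_def by blast
  have id: "u v = v"
    if "universal_for P X M \<mu>" "P M" "\<mu> \<in> X \<rightarrow> carrier M" "magma M" "u \<in> magma_hom M M"
      "\<And>x. x \<in> X \<Longrightarrow> u (\<mu> x) = \<mu> x" "v \<in> carrier M" for P and M :: "'m magma" and \<mu> u v
  proof -
    have "\<exists>!w. w \<in> magma_hom M M \<and> w \<in> extensional (carrier M) \<and> (\<forall>x\<in>X. w (\<mu> x) = \<mu> x)"
      using that(1-3) unfolding universal_for_def by blast
    moreover have "restrict w (carrier M) \<in> magma_hom M M \<and> restrict w (carrier M) \<in> extensional (carrier M)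
        \<and> (\<forall>x\<in>X. restrict w (carrier M) (\<mu> x) = \<mu> x)"
      if "w \<in> magma_hom M M" "\<And>x. x \<in> X \<Longrightarrow> w (\<mu> x) = \<mu> x" for w
      using that \<open>\<mu> \<in> X \<rightarrow> carrier M\<close> magma.closed[OF \<open>magma M\<close>] by (auto simp: magma_hom_def Pi_iff)
    moreover have "(\<lambda>x. x) \<in> magma_hom M M"
      by (simp add: magma_hom_def)
    ultimately have "restrict u (carrier M) = restrict (\<lambda>x. x) (carrier M)"
      using that(5,6) by blast
    then show ?thesis
      using that(7) by (metis restrict_apply')
  qed
  have "h' (h v) = v" if "v \<in> carrier F" for v
    using id[OF F(1) \<open>PF F\<close> \<iota> closed(1), of "\<lambda>v. h' (h v)" v] h h' that
    by (auto simp: magma_hom_def Pi_iff)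
  moreover have "h (h' v) = v" if "v \<in> carrier A" for v
    using id[OF A(2) \<open>PA A\<close> \<kappa> closed(2), of "\<lambda>v. h (h' v)" v] h h' that
    by (auto simp: magma_hom_def Pi_iff)
  ultimately have "bij_betw h (carrier F) (carrier A)"
    using h(1) h'(1) by (intro bij_betw_byWitness[where f' = h']) (auto simp: magma_hom_def)
  then show ?thesis
    using h(1) unfolding magma_isomorphic_def magma_iso_def by blast
qed

section \<open>The two rings\<close>

lemma free_module_minus:
  assumes "cring R" "v \<in> carrier (free_module R k)" "w \<in> carrier (free_module R k)"
  shows "v \<ominus>\<^bsub>free_module R k\<^esub> w = (\<lambda>i\<in>{..<k}. v i \<ominus>\<^bsub>R\<^esub> w i)"
proof -
  interpret R: cring R by fact
  interpret M: Module.module R "free_module R k" by (rule module_free_module) fact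
  have "\<ominus>\<^bsub>free_module R k\<^esub> w = (\<lambda>i\<in>{..<k}. \<ominus>\<^bsub>R\<^esub> w i)"
    using assms(3) by (intro M.minus_equality)
      (auto simp: free_module_simps R.l_neg fun_eq_iff restrict_def extensional_def)
  then show ?thesis
    by (auto simp: a_minus_def free_module_simps)
qed

lemma ring_on_minus:
  assumes "cring (ring_on S)" "x \<in> S" "y \<in> S"
  shows "x \<ominus>\<^bsub>ring_on S\<^esub> y = x - y"
proof -
  interpret cring "ring_on S" by fact
  have *: "carrier (ring_on S) = S" "a \<oplus>\<^bsub>ring_on S\<^esub> b = a + b" "\<zero>\<^bsub>ring_on S\<^esub> = 0" for a b
    by (simp_all add: ring_on_def)
  have "\<ominus>\<^bsub>ring_on S\<^esub> y \<oplus>\<^bsub>ring_on S\<^esub> y = \<zero>\<^bsub>ring_on S\<^esub>"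
    using assms(3) by (intro l_neg) (simp add: *)
  then have "\<ominus>\<^bsub>ring_on S\<^esub> y = - y"
    by (simp add: * eq_neg_iff_add_eq_0)
  then show ?thesis
    by (simp add: a_minus_def *)
qed

lemma LL_ring_on: "LL = ring_on (carrier LL)" and DD_ring_on: "DD = ring_on (carrier DD)"
  by (simp_all add: LL_def DD_def ring_on_def)

lemma LL_inverse_mem: "LL_t \<in> carrier LL" "1 / LL_t \<in> carrier LL" "1 / (1 - LL_t) \<in> carrier LL"
  and LL_t_nonzero: "LL_t \<noteq> 0" "LL_t \<noteq> 1"
proof -
  show "LL_t \<noteq> 0" "LL_t \<noteq> 1"
    by (simp_all add: LL_t_def Zero_fract_def One_fract_def eq_fract one_pCons)
  have inv: "1 / x \<in> carrier LL" if "x \<in> Units LL" for x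
  proof -
    from that obtain y where "y \<in> carrier LL" "x * y = 1"
      by (auto simp: Units_def LL_def ring_on_def)
    then show ?thesis by (metis nonzero_mult_div_cancel_left mult_zero_left zero_neq_one)
  qed
  show "LL_t \<in> carrier LL" "1 / LL_t \<in> carrier LL" "1 / (1 - LL_t) \<in> carrier LL"
    using LL_units inv by (auto simp: Units_def)
qed

text \<open>
  Integers, then polynomials by the Horner scheme, then fractions by repeatedly dividing by \<open>t (1 - t)\<close>.
\<close>
lemma LL_generated:
  assumes T: "1 \<in> T" "\<And>x y. x \<in> T \<Longrightarrow> y \<in> T \<Longrightarrow> x - y \<in> T" "\<And>x. x \<in> T \<Longrightarrow> LL_t * x \<in> T"
    "\<And>x. x \<in> T \<Longrightarrow> (1 / LL_t) * x \<in> T" "\<And>x. x \<in> T \<Longrightarrow> (1 / (1 - LL_t)) * x \<in> T"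
  shows "carrier LL \<subseteq> T"
proof
  have zero: "0 \<in> T" using T(2)[OF T(1) T(1)] by simp
  have add: "x + y \<in> T" if "x \<in> T" "y \<in> T" for x y
    using T(2)[OF that(1) T(2)[OF zero that(2)]] by simp
  have int: "of_int c \<in> T" for c
    by (induction c rule: int_induct[where k = 0]) (auto simp: zero add T(1,2))
  have of_int: "Fract [:c:] 1 = of_int c" for c :: int
  proof (induction c rule: int_induct[where k = 0])
    case (step1 c)
    have "Fract [:c + 1:] 1 = Fract [:c:] 1 + 1"
      by (simp add: One_fract_def one_pCons)
    then show ?case using step1 by simp
  next
    case (step2 c)
    have "Fract [:c - 1:] 1 = Fract [:c:] 1 - 1"
      by (simp add: One_fract_def one_pCons)
    then show ?case using step2 by simp
  qed (simp add: Zero_fract_def)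
  have poly: "Fract p 1 \<in> T" for p
  proof (induction p)
    case 0
    then show ?case using zero by (simp add: Zero_fract_def)
  next
    case (pCons c p)
    have "Fract (pCons c p) 1 = of_int c + LL_t * Fract p 1"
      by (simp add: LL_t_def of_int[symmetric])
    then show ?case using pCons by (simp add: add int T(3))
  qed
  fix x assume "x \<in> carrier LL"
  then obtain p k where x: "x = Fract p 1 / Fract ([:0, 1:] * [:1, -1:]) 1 ^ k"
    unfolding carrier_LL by blast
  have d: "Fract ([:0, 1:] * [:1, -1:]) 1 = LL_t * (1 - LL_t)"
    by (simp add: LL_t_def One_fract_def one_pCons)
  have "y / (LL_t * (1 - LL_t)) ^ k \<in> T" if "y \<in> T" for y k
  proof (induction k)
    case (Suc k)
    then show ?case using T(4)[OF T(5)[OF Suc]] by (simp add: field_simps)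
  qed (use that in simp)
  then show "x \<in> T" using poly by (simp only: x d)
qed

lemma affine_power_quandle_LL:
  "affine_power_quandle (carrier LL) LL_t k
    (Alex (free_module LL k) (\<lambda>v. LL_t \<odot>\<^bsub>free_module LL k\<^esub> v))" (is "affine_power_quandle _ _ _ ?A")
proof
  interpret LL: cring LL by (rule cring_LL)
  have ops: "x \<otimes>\<^bsub>LL\<^esub> y = x * y" "x \<oplus>\<^bsub>LL\<^esub> y = x + y" "\<one>\<^bsub>LL\<^esub> = 1" for x y
    by (simp_all add: LL_def ring_on_def)
  have minus: "x \<ominus>\<^bsub>LL\<^esub> y = x - y" if "x \<in> carrier LL" "y \<in> carrier LL" for x y
    using ring_on_minus[of "carrier LL" x y] LL_ring_on cring_LL that by metis
  show "x - y \<in> carrier LL" if "x \<in> carrier LL" "y \<in> carrier LL" for x y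
    using LL.minus_closed[OF that] minus[OF that] by simp
  show "x * y \<in> carrier LL" if "x \<in> carrier LL" "y \<in> carrier LL" for x y
    using LL.m_closed[OF that] by (simp add: ops)
  show "1 \<in> carrier LL"
    using LL.one_closed by (simp add: ops)
  show "carrier ?A = {..<k} \<rightarrow>\<^sub>E carrier LL"
    by (simp add: Alex_def free_module_def)
  fix v w assume "v \<in> carrier ?A" "w \<in> carrier ?A"
  then have v: "v \<in> carrier (free_module LL k)" and w: "w \<in> carrier (free_module LL k)"
    by (simp_all add: Alex_def)
  have tw: "LL_t \<odot>\<^bsub>free_module LL k\<^esub> w \<in> carrier (free_module LL k)"
    using w LL_inverse_mem(1) LL.m_closed by (auto simp: free_module_simps)
  show "v \<star>\<^bsub>?A\<^esub> w = (\<lambda>i\<in>{..<k}. LL_t * v i + (1 - LL_t) * w i)"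
  proof -
    have "v \<star>\<^bsub>?A\<^esub> w = LL_t \<odot>\<^bsub>free_module LL k\<^esub> v \<oplus>\<^bsub>free_module LL k\<^esub>
        (\<lambda>i\<in>{..<k}. w i \<ominus>\<^bsub>LL\<^esub> (LL_t \<odot>\<^bsub>free_module LL k\<^esub> w) i)"
      by (simp add: Alex_def free_module_minus[OF cring_LL w tw])
    also have "\<dots> = (\<lambda>i\<in>{..<k}. LL_t * v i + (1 - LL_t) * w i)"
      using w tw by (auto simp: free_module_simps ops minus algebra_simps)
    finally show ?thesis .
  qed
qed (use LL_inverse_mem LL_t_nonzero LL_generated in auto)

lemma DD_generated:
  assumes T: "1 \<in> T" "\<And>x y. x \<in> T \<Longrightarrow> y \<in> T \<Longrightarrow> x - y \<in> T" "\<And>x. x \<in> T \<Longrightarrow> 1 / 2 * x \<in> T"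
  shows "carrier DD \<subseteq> T"
proof
  have zero: "0 \<in> T" using T(2)[OF T(1) T(1)] by simp
  have add: "x + y \<in> T" if "x \<in> T" "y \<in> T" for x y
    using T(2)[OF that(1) T(2)[OF zero that(2)]] by simp
  have int: "of_int c \<in> T" for c
    by (induction c rule: int_induct[where k = 0]) (auto simp: zero add T(1,2))
  have "of_int c / 2 ^ k \<in> T" for c k
  proof (induction k)
    case (Suc k)
    then show ?case using T(3)[OF Suc] by simp
  qed (simp add: int)
  then show "x \<in> T" if "x \<in> carrier DD" for x
    using that by (auto simp: carrier_DD)
qed

lemma affine_power_quandle_DD: "affine_power_quandle (carrier DD) (1 / 2) k (mid (free_module DD k))"
proof
  interpret DD: cring DD by (rule cring_DD)
  have ops: "x \<otimes>\<^bsub>DD\<^esub> y = x * y" "x \<oplus>\<^bsub>DD\<^esub> y = x + y" "\<one>\<^bsub>DD\<^esub> = 1" for x y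
    by (simp_all add: DD_def ring_on_def)
  have minus: "x \<ominus>\<^bsub>DD\<^esub> y = x - y" if "x \<in> carrier DD" "y \<in> carrier DD" for x y
    using ring_on_minus[of "carrier DD" x y] DD_ring_on cring_DD that by metis
  show "x - y \<in> carrier DD" if "x \<in> carrier DD" "y \<in> carrier DD" for x y
    using DD.minus_closed[OF that] minus[OF that] by simp
  show "x * y \<in> carrier DD" if "x \<in> carrier DD" "y \<in> carrier DD" for x y
    using DD.m_closed[OF that] by (simp add: ops)
  have "of_int 1 / of_int 2 ^ 1 \<in> carrier DD" "of_int 2 / of_int 2 ^ 0 \<in> carrier DD"
    unfolding carrier_DD by blast+
  then show "1 / 2 \<in> carrier DD" "1 / (1 / 2) \<in> carrier DD" "1 / (1 - 1 / 2) \<in> carrier DD"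
    by simp_all
  show "1 \<in> carrier DD"
    using DD.one_closed by (simp add: ops)
  show "carrier (mid (free_module DD k)) = {..<k} \<rightarrow>\<^sub>E carrier DD"
    by (simp add: mid_def free_module_def)
  show "v \<star>\<^bsub>mid (free_module DD k)\<^esub> w = (\<lambda>i\<in>{..<k}. 1 / 2 * v i + (1 - 1 / 2) * w i)" for v w
    by (auto simp: mid_def free_module_simps ops distrib_left add_divide_distrib)
qed (use DD_generated in auto)

lemma free_medial_latin_Alex:
  assumes "bij_betw b X {..k}"
  shows "free_medial_latin TYPE('q) X (Alex (free_module LL k) (\<lambda>v. LL_t \<odot>\<^bsub>free_module LL k\<^esub> v))
    (affine_power_quandle.frame k \<circ> b)"
proof -
  interpret affine_power_quandle "carrier LL" LL_t k
    "Alex (free_module LL k) (\<lambda>v. LL_t \<odot>\<^bsub>free_module LL k\<^esub> v)"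
    by (rule affine_power_quandle_LL)
  have "inj_on (frame \<circ> b) X"
    using assms inj_on_frame by (simp add: bij_betw_def comp_inj_on)
  then show ?thesis
    unfolding free_medial_latin_def
    using medial_latin frame_mem universal_for_frame[OF assms, of medial_latin_quandle]
      medial_latin_quandle.orbit_map_LL by auto
qed

lemma free_medial_commutative_mid:
  assumes "bij_betw b X {..k}"
  shows "free_medial_commutative TYPE('q) X (mid (free_module DD k)) (affine_power_quandle.frame k \<circ> b)"
proof -
  interpret affine_power_quandle "carrier DD" "1 / 2" k "mid (free_module DD k)"
    by (rule affine_power_quandle_DD)
  have "inj_on (frame \<circ> b) X"
    using assms inj_on_frame by (simp add: bij_betw_def comp_inj_on)
  then show ?thesis
    unfolding free_medial_commutative_def
    using medial_commutative frame_mem universal_for_frame[OF assms, of medial_commutative_quandle]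
      medial_commutative_quandle.medial_latin medial_commutative_quandle.orbit_map_DD by auto
qed

theorem proposition6p1:
  fixes X :: "'x set" and n :: nat
  assumes "finite X" and "card X = n" and "1 \<le> n"
  shows
    "(let M = free_module LL (n - 1); A = Alex M (\<lambda>v. LL_t \<odot>\<^bsub>M\<^esub> v) in
       (\<exists>\<iota>. free_medial_latin TYPE('q) X A \<iota>) \<and>
       (\<forall>(FML :: 'f magma) \<iota>.
          free_medial_latin TYPE('f) X FML \<iota> \<and>
          free_medial_latin TYPE(nat \<Rightarrow> int poly fract) X FML \<iota> \<longrightarrow> FML \<cong>\<^sub>m A)) \<and>
     (let B = mid (free_module DD (n - 1)) in
       (\<exists>\<iota>. free_medial_commutative TYPE('q) X B \<iota>) \<and>
       (\<forall>(FMC :: 'f magma) \<iota>.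
          free_medial_commutative TYPE('f) X FMC \<iota> \<and>
          free_medial_commutative TYPE(nat \<Rightarrow> rat) X FMC \<iota> \<longrightarrow> FMC \<cong>\<^sub>m B))"
proof -
  have "card X = card {..n - 1}"
    using assms by simp
  then obtain b where b: "bij_betw b X {..n - 1}"
    using assms(1) finite_same_card_bij by blast
  define \<kappa>\<^sub>L :: "'x \<Rightarrow> nat \<Rightarrow> int poly fract" where "\<kappa>\<^sub>L = affine_power_quandle.frame (n - 1) \<circ> b"
  define \<kappa>\<^sub>D :: "'x \<Rightarrow> nat \<Rightarrow> rat" where "\<kappa>\<^sub>D = affine_power_quandle.frame (n - 1) \<circ> b"
  let ?A = "Alex (free_module LL (n - 1)) (\<lambda>v. LL_t \<odot>\<^bsub>free_module LL (n - 1)\<^esub> v)"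
  let ?B = "mid (free_module DD (n - 1))"
  have "FML \<cong>\<^sub>m ?A"
    if "free_medial_latin TYPE('f) X FML \<iota>" "free_medial_latin TYPE(nat \<Rightarrow> int poly fract) X FML \<iota>"
    for FML :: "'f magma" and \<iota>
    using that free_medial_latin_Alex[OF b, where 'q = 'f, folded \<kappa>\<^sub>L_def]
      free_medial_latin_Alex[OF b, where 'q = "nat \<Rightarrow> int poly fract", folded \<kappa>\<^sub>L_def]
    unfolding free_medial_latin_def
    by (intro universal_unique[of medial_latin_quandle FML medial_latin_quandle ?A \<iota> X \<kappa>\<^sub>L])
      (auto dest: medial_latin_quandle.axioms medial_quandle.axioms quandle.axioms rack.axioms)
  moreover have "FMC \<cong>\<^sub>m ?B"
    if "free_medial_commutative TYPE('f) X FMC \<iota>" "free_medial_commutative TYPE(nat \<Rightarrow> rat) X FMC \<iota>"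
    for FMC :: "'f magma" and \<iota>
    using that free_medial_commutative_mid[OF b, where 'q = 'f, folded \<kappa>\<^sub>D_def]
      free_medial_commutative_mid[OF b, where 'q = "nat \<Rightarrow> rat", folded \<kappa>\<^sub>D_def]
    unfolding free_medial_commutative_def
    by (intro universal_unique[of medial_commutative_quandle FMC medial_commutative_quandle ?B \<iota> X \<kappa>\<^sub>D])
      (auto dest: medial_commutative_quandle.axioms medial_quandle.axioms quandle.axioms rack.axioms)
  ultimately show ?thesis
    using free_medial_latin_Alex[OF b, where 'q = 'q] free_medial_commutative_mid[OF b, where 'q = 'q]
    unfolding Let_def by blast
qed

end
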